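(* Let $m$ be a square-free positive integer such that the ring of integers $\mathcal{O}_{-m}$ of $\mathbb{Q}(\sqrt{-m})$ has unit group $\{\pm1\}$, and let $\Gamma$ be a finite index subgroup of the Bianchi group $\mathrm{PSL}_2(\mathcal{O}_{-m})$. For any element $\gamma\in\Gamma$ of order $3$, the quotient space $\mathcal{H}^\gamma / C_\Gamma(\gamma)$ of the rotation axis of $\gamma$ modulo the centralizer of $\gamma$ in $\Gamma$ is homeomorphic to a circle.
   Context: $\mathcal{H}=\mathcal{H}^3_{\mathbb{R}}$ is real hyperbolic 3-space, on which $\mathrm{PSL}_2(\mathbb{C})$ acts as the group of orientation preserving isometries. A non-trivial element $\gamma\in\Gamma$ of finite order acts as a rotation around a geodesic line, its rotation axis, which is the fixed point set $\mathcal{H}^\gamma$. $C_\Gamma(\gamma)$ is the centralizer of $\gamma$ in $\Gamma$; it acts on $\mathcal{H}^\gamma$. *)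

theory Defs
  imports
    "HOL-Analysis.Analysis"
    "HOL-Algebra.Group_Action"
    "HOL-Algebra.Multiplicative_Group"
    "HOL-Computational_Algebra.Squarefree"
begin

definition imag_quadratic_field :: "nat \<Rightarrow> complex set" where
  "imag_quadratic_field m = {a + b * csqrt (- of_nat m) | a b. a \<in> \<rat> \<and> b \<in> \<rat>}"

definition ring_of_integers :: "nat \<Rightarrow> complex set" where
  "ring_of_integers m = {x \<in> imag_quadratic_field m. algebraic_int x}"

definition SL2 :: "complex set \<Rightarrow> (complex^2^2) monoid" where
  "SL2 R = \<lparr>carrier = {A. (\<forall>i j. A $ i $ j \<in> R) \<and> det A = 1},
            monoid.mult = (**), one = mat 1\<rparr>"

text \<open>The elements of the quotient are the sets \<open>{A, - A}\<close>. Hence, for a subring \<open>R\<close> of the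
  complex numbers, \<open>PSL2 R\<close> is literally a subgroup of \<open>PSL2 UNIV\<close>, that is of
  \<open>PSL\<close> of rank two over the complex numbers.\<close>

definition PSL2 :: "complex set \<Rightarrow> (complex^2^2) set monoid" where
  "PSL2 R = SL2 R Mod {mat 1, - mat 1}"

definition bianchi_group :: "nat \<Rightarrow> (complex^2^2) set monoid" where
  "bianchi_group m = PSL2 (ring_of_integers m)"

definition centralizer :: "('a, 'b) monoid_scheme \<Rightarrow> 'a \<Rightarrow> 'a set" where
  "centralizer G x = {g \<in> carrier G. g \<otimes>\<^bsub>G\<^esub> x = x \<otimes>\<^bsub>G\<^esub> g}"

lemma SL2_sel [simp]:
  "carrier (SL2 R) = {A. (\<forall>i j. A $ i $ j \<in> R) \<and> det A = 1}"
  "A \<otimes>\<^bsub>SL2 R\<^esub> B = A ** B" "\<one>\<^bsub>SL2 R\<^esub> = mat 1"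
  by (auto simp: SL2_def)

lemma matrix_mult_uminus_2:
  fixes A B :: "complex^2^2"
  shows "(- A) ** B = - (A ** B)" "A ** (- B) = - (A ** B)"
  by (simp_all add: vec_eq_iff matrix_matrix_mult_def sum_negf)

lemma det_uminus_2: "det (- A) = det (A :: complex^2^2)"
  by (simp add: det_2)

lemma group_SL2:
  assumes "0 \<in> R" "1 \<in> R" "\<And>x. x \<in> R \<Longrightarrow> - x \<in> R"
    and "\<And>x y. x \<in> R \<Longrightarrow> y \<in> R \<Longrightarrow> x + y \<in> R"
    and "\<And>x y. x \<in> R \<Longrightarrow> y \<in> R \<Longrightarrow> x * y \<in> R"
  shows "group (SL2 R)"
proof (rule groupI)
  fix A assume A: "A \<in> carrier (SL2 R)"
  define B :: "complex^2^2" where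
    "B = vector [vector [A $ 2 $ 2, - (A $ 1 $ 2)], vector [- (A $ 2 $ 1), A $ 1 $ 1]]"
  have "B \<in> carrier (SL2 R)"
    using A assms by (auto simp: B_def forall_2 det_2 algebra_simps)
  moreover have "B ** A = mat 1"
    using A by (auto simp: B_def vec_eq_iff matrix_matrix_mult_def sum_2 forall_2 mat_def det_2
        algebra_simps)
  ultimately show "\<exists>B\<in>carrier (SL2 R). B \<otimes>\<^bsub>SL2 R\<^esub> A = \<one>\<^bsub>SL2 R\<^esub>"
    by auto
next
  show "\<one>\<^bsub>SL2 R\<^esub> \<in> carrier (SL2 R)"
    using assms by (simp add: det_I) (simp add: mat_def)
next
  fix A B assume "A \<in> carrier (SL2 R)" "B \<in> carrier (SL2 R)"
  then show "A \<otimes>\<^bsub>SL2 R\<^esub> B \<in> carrier (SL2 R)"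
    using assms(4,5) by (simp add: det_mul) (simp add: matrix_matrix_mult_def sum_2)
qed (simp_all add: matrix_mul_assoc)

lemma group_PSL2:
  assumes "0 \<in> R" "1 \<in> R" "\<And>x. x \<in> R \<Longrightarrow> - x \<in> R"
    and "\<And>x y. x \<in> R \<Longrightarrow> y \<in> R \<Longrightarrow> x + y \<in> R"
    and "\<And>x y. x \<in> R \<Longrightarrow> y \<in> R \<Longrightarrow> x * y \<in> R"
  shows "group (PSL2 R)"
proof -
  interpret group "SL2 R" by (rule group_SL2) fact+
  let ?N = "{mat 1, - mat 1 :: complex^2^2}"
  have mem: "- mat 1 \<in> carrier (SL2 R)"
    using assms by (auto simp: mat_def det_uminus_2) (simp add: det_2)
  have inv1: "inv\<^bsub>SL2 R\<^esub> (- mat 1) = - mat 1"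
    using mem by (intro inv_equality) (auto simp: matrix_mult_uminus_2)
  have "subgroup ?N (SL2 R)"
    using mem inv1 one_closed inv_one by unfold_locales (auto simp: matrix_mult_uminus_2)
  then have "?N \<lhd> SL2 R"
    by (rule normalI) (auto simp: r_coset_def l_coset_def matrix_mult_uminus_2)
  then show ?thesis
    unfolding PSL2_def by (rule normal.factorgroup_is_group)
qed

lemma carrier_PSL2: "carrier (PSL2 R) = {{A, - A} | A. A \<in> carrier (SL2 R)}"
  by (auto simp: PSL2_def FactGroup_def RCOSETS_def r_coset_def matrix_mult_uminus_2)

text \<open>Upper half-space model. The topology of the hyperbolic metric is the Euclidean subspace
  topology.\<close>

definition hyperbolic_space3 :: "(complex \<times> real) set" where
  "hyperbolic_space3 = {(z, t). t > 0}"

text \<open>With \<open>(z, t)\<close> regarded as the quaternion \<open>P = z + t j\<close>, this is the Moebius action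
  \<open>P \<mapsto> (a P + b) (c P + d)\<^sup>-\<^sup>1\<close> (Poincare extension).\<close>

definition sl2_act :: "complex^2^2 \<Rightarrow> complex \<times> real \<Rightarrow> complex \<times> real" where
  "sl2_act A = (\<lambda>(z, t).
     let a = A $ 1 $ 1; b = A $ 1 $ 2; c = A $ 2 $ 1; d = A $ 2 $ 2;
         N = (norm (c * z + d))\<^sup>2 + (norm c)\<^sup>2 * t\<^sup>2
     in (((a * z + b) * cnj (c * z + d) + a * cnj c * of_real (t\<^sup>2)) / of_real N, t / N))"

text \<open>All representatives of \<open>g\<close> act in the same way, so the image below is a singleton.\<close>

definition psl2_act :: "(complex^2^2) set \<Rightarrow> complex \<times> real \<Rightarrow> complex \<times> real" where
  "psl2_act g p = the_elem ((\<lambda>A. sl2_act A p) ` g)"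

lemma sl2_act_uminus [simp]: "sl2_act (- A) p = sl2_act A p"
proof (cases p)
  case (Pair z t)
  have "- (A $ i $ 1) * z + - (A $ i $ 2) = - (A $ i $ 1 * z + A $ i $ 2)" for i
    by simp
  then show ?thesis
    unfolding Pair sl2_act_def Let_def vector_uminus_component prod.case
    by (simp only: norm_minus_cancel complex_cnj_minus minus_mult_minus)
qed

lemma psl2_act_eq [simp]: "psl2_act {A, - A} p = sl2_act A p"
  by (simp add: psl2_act_def)

lemma sl2_act_one: "sl2_act (mat 1) p = p"
  by (simp add: sl2_act_def mat_def Let_def split: prod.splits)

lemma sl2_act_denominator_pos:
  fixes A :: "complex^2^2"
  assumes "det A = 1" "t > 0"
  shows "(norm (A $ 2 $ 1 * z + A $ 2 $ 2))\<^sup>2 + (norm (A $ 2 $ 1))\<^sup>2 * t\<^sup>2 > 0"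
proof (cases "A $ 2 $ 1 = 0")
  case True
  then show ?thesis using assms by (auto simp: det_2)
next
  case False
  then show ?thesis using assms by (intro add_nonneg_pos) auto
qed

lemma sl2_act_closed:
  assumes "det A = 1" "p \<in> hyperbolic_space3"
  shows "sl2_act A p \<in> hyperbolic_space3"
  using assms sl2_act_denominator_pos[OF assms(1)]
  by (auto simp: hyperbolic_space3_def sl2_act_def Let_def)

lemma sl2_act_mult:
  assumes A: "det A = 1" and B: "det B = 1" and p: "p \<in> hyperbolic_space3"
  shows "sl2_act (B ** A) p = sl2_act B (sl2_act A p)"
proof -
  obtain z t where p_eq: "p = (z, t)" and t: "t > 0"
    using p by (auto simp: hyperbolic_space3_def)
  define a b c d where "a = A $ 1 $ 1" "b = A $ 1 $ 2" "c = A $ 2 $ 1" "d = A $ 2 $ 2"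
  define e f g h where "e = B $ 1 $ 1" "f = B $ 1 $ 2" "g = B $ 2 $ 1" "h = B $ 2 $ 2"
  note defs = a_b_c_d_def e_f_g_h_def
  define N where "N = (norm (c * z + d))\<^sup>2 + (norm c)\<^sup>2 * t\<^sup>2"
  define M where "M = (norm (a * z + b))\<^sup>2 + (norm a)\<^sup>2 * t\<^sup>2"
  define n where "n = (a * z + b) * cnj (c * z + d) + a * cnj c * of_real (t\<^sup>2)"
  define N' where "N' = (norm (g * (n / N) + h))\<^sup>2 + (norm g)\<^sup>2 * (t / N)\<^sup>2"
  define n' where "n' = (e * (n / N) + f) * cnj (g * (n / N) + h) + e * cnj g * of_real ((t / N)\<^sup>2)"
  define D where "D = (norm ((g*a+h*c) * z + (g*b+h*d)))\<^sup>2 + (norm (g*a+h*c))\<^sup>2 * t\<^sup>2"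
  define k where "k = ((e*a+f*c) * z + (e*b+f*d)) * cnj ((g*a+h*c) * z + (g*b+h*d))
      + (e*a+f*c) * cnj (g*a+h*c) * of_real (t\<^sup>2)"
  define u v T where "u = a * z + b" and "v = c * z + d" and "T = complex_of_real (t\<^sup>2)"
  note uvT = u_def[symmetric] v_def[symmetric] T_def[symmetric]
  have N: "N > 0"
    using sl2_act_denominator_pos[OF A t, of z] by (simp add: N_def defs)
  have cN: "complex_of_real N = v * cnj v + c * cnj c * T"
    unfolding N_def uvT by (simp only: of_real_add of_real_mult complex_norm_square T_def)
  have cM: "complex_of_real M = u * cnj u + a * cnj a * T"
    unfolding M_def uvT by (simp only: of_real_add of_real_mult complex_norm_square T_def)
  have n: "n = u * cnj v + a * cnj c * T"
    unfolding n_def uvT ..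
  have T [simp]: "cnj T = T"
    by (simp add: T_def)
  have "u * c - a * v = - det A"
    by (simp add: u_def v_def det_2 defs algebra_simps)
  then have det: "u * c - a * v = - 1"
    using A by simp
  have "n * cnj n + T * ((u * c - a * v) * cnj (u * c - a * v)) = of_real N * of_real M"
    unfolding cN cM n complex_cnj_add complex_cnj_diff complex_cnj_mult complex_cnj_cnj T
    by (simp add: algebra_simps)
  then have key: "n * cnj n + T = of_real N * of_real M"
    by (simp add: det)
  have lin: "(x*a+y*c) * z + (x*b+y*d) = x * u + y * v" for x y
    by (simp add: u_def v_def algebra_simps)
  have general: "(x * u + y * v) * cnj (g * u + h * v) + (x*a+y*c) * cnj (g*a+h*c) * T
      = x * cnj g * of_real M + x * cnj h * n + y * cnj g * cnj n + y * cnj h * of_real N" for x y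
    unfolding cN cM n complex_cnj_add complex_cnj_mult complex_cnj_cnj T
    by (simp add: algebra_simps)
  have cD: "complex_of_real D = (g * u + h * v) * cnj (g * u + h * v)
      + (g*a+h*c) * cnj (g*a+h*c) * T"
    unfolding D_def lin by (simp only: of_real_add of_real_mult complex_norm_square T_def)
  have ck: "k = (e * u + f * v) * cnj (g * u + h * v) + (e*a+f*c) * cnj (g*a+h*c) * T"
    unfolding k_def lin T_def ..
  have cN': "complex_of_real N' = (g * (n / N) + h) * cnj (g * (n / N) + h)
      + g * cnj g * of_real ((t / N)\<^sup>2)"
    unfolding N'_def by (simp only: of_real_add of_real_mult complex_norm_square)
  have general': "(x * (n / N) + y) * cnj (g * (n / N) + h) + x * cnj g * of_real ((t / N)\<^sup>2)
      = (x * cnj g * of_real M + x * cnj h * n + y * cnj g * cnj n + y * cnj h * of_real N) / of_real N" for x y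
  proof -
    define r where "r = inverse (complex_of_real N)"
    have r: "r * of_real N = 1" "cnj r = r"
      using N by (auto simp: r_def)
    have "of_real ((t / N)\<^sup>2) = T * r\<^sup>2"
      by (simp add: T_def r_def divide_inverse power_mult_distrib power_inverse)
    moreover have "(x * (n * r) + y) * (cnj g * (cnj n * r) + cnj h) + x * cnj g * (T * r\<^sup>2)
      = (x * cnj g * of_real M + x * cnj h * n + y * cnj g * cnj n + y * cnj h * of_real N) * r"
      (is "?lhs = ?rhs")
    proof -
      have "?lhs = x * cnj g * (n * cnj n + T) * r\<^sup>2 + x * cnj h * n * r + y * cnj g * cnj n * r + y * cnj h"
        by (simp add: algebra_simps power2_eq_square)
      also have "\<dots> = x * cnj g * of_real M * r + x * cnj h * n * r + y * cnj g * cnj n * r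
          + y * cnj h * (r * of_real N)"
        unfolding key r(1) mult_1_right using r(1) by (simp add: power2_eq_square mult.commute)
      also have "\<dots> = ?rhs"
        unfolding r(1) using r(1) by (simp add: algebra_simps)
      finally show ?thesis .
    qed
    ultimately show ?thesis
      by (simp add: divide_inverse r_def[symmetric] r(2))
  qed
  have "complex_of_real N' = complex_of_real (D / N)"
    unfolding cN' general' of_real_divide cD general ..
  then have N'D: "N' = D / N" by (simp only: of_real_eq_iff)
  have n'k: "n' = k / of_real N"
    unfolding n'_def general' ck general ..
  have "sl2_act A p = (n / of_real N, t / N)"
    unfolding sl2_act_def p_eq Let_def n_def N_def defs by simp
  then have "sl2_act B (sl2_act A p) = sl2_act B (n / of_real N, t / N)"
    by simp
  also have "\<dots> = (n' / of_real N', (t / N) / N')"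
    unfolding sl2_act_def Let_def n'_def N'_def defs prod.case ..
  also have "\<dots> = (k / of_real D, t / D)"
    unfolding N'D n'k using N by simp
  also have "\<dots> = sl2_act (B ** A) p"
  proof -
    have "(B ** A) $ i $ j = B $ i $ 1 * A $ 1 $ j + B $ i $ 2 * A $ 2 $ j" for i j
      by (simp add: matrix_matrix_mult_def sum_2)
    then show ?thesis
      unfolding sl2_act_def p_eq Let_def k_def D_def defs prod.case by (simp only:)
  qed
  finally have "sl2_act B (sl2_act A p) = sl2_act (B ** A) p" .
  then show ?thesis by simp
qed

definition quotient_topology :: "'a topology \<Rightarrow> ('a \<Rightarrow> 'b) \<Rightarrow> 'b topology" where
  "quotient_topology X q =
     topology (\<lambda>V. V \<subseteq> q ` topspace X \<and> openin X {x \<in> topspace X. q x \<in> V})"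

definition orbit_space ::
    "('g, 'c) monoid_scheme \<Rightarrow> ('g \<Rightarrow> 'a \<Rightarrow> 'a) \<Rightarrow> 'a topology \<Rightarrow> 'a set topology" where
  "orbit_space G \<phi> X = quotient_topology X (orbit G \<phi>)"

lemma openin_quotient_topology:
  "openin (quotient_topology X q) V \<longleftrightarrow>
     V \<subseteq> q ` topspace X \<and> openin X {x \<in> topspace X. q x \<in> V}"
proof -
  have "istopology (\<lambda>V. V \<subseteq> q ` topspace X \<and> openin X {x \<in> topspace X. q x \<in> V})"
    unfolding istopology_def
  proof (rule conjI, goal_cases)
    case 1
    have "{x \<in> topspace X. q x \<in> S \<inter> T} = {x \<in> topspace X. q x \<in> S} \<inter> {x \<in> topspace X. q x \<in> T}"
      for S T by auto
    then show ?case by auto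
  next
    case 2
    have "{x \<in> topspace X. q x \<in> \<Union>\<K>} = (\<Union>V\<in>\<K>. {x \<in> topspace X. q x \<in> V})" for \<K>
      by auto
    then show ?case by (auto intro!: openin_Union)
  qed
  then show ?thesis
    by (simp add: quotient_topology_def)
qed

lemma topspace_quotient_topology [simp]: "topspace (quotient_topology X q) = q ` topspace X"
proof
  show "topspace (quotient_topology X q) \<subseteq> q ` topspace X"
    using openin_topspace[of "quotient_topology X q"] by (simp only: openin_quotient_topology)
  have "{x \<in> topspace X. q x \<in> q ` topspace X} = topspace X" by blast
  then have "openin (quotient_topology X q) (q ` topspace X)"
    by (simp only: openin_quotient_topology openin_topspace subset_refl simp_thms)
  then show "q ` topspace X \<subseteq> topspace (quotient_topology X q)"
    by (rule openin_subset)
qed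

lemma quotient_map_quotient_topology: "quotient_map X (quotient_topology X q) q"
  by (simp add: quotient_map_def openin_quotient_topology)

end

theory Submission
  imports Defs "HOL-Analysis.Kronecker_Approximation_Theorem"
begin

text \<open>After a change of sign, \<open>\<gamma>\<close> is represented by a matrix \<open>A\<close> of trace 1. Diagonalising \<open>A\<close> over the
  complex numbers carries its axis to the vertical line over 0, and everything that commutes with
  \<open>\<gamma>\<close> in \<open>PSL\<close> commutes with \<open>A\<close> itself (otherwise the trace would vanish). Hence the centralizer
  acts on the axis by translations, by \<open>2 ln |\<lambda>|\<close> where \<open>\<lambda>\<close> is an eigenvalue. These translation lengths
  form a discrete group, because traces lie in the discrete ring of integers. The group is
  non-trivial: since \<open>m \<noteq> 3\<close>, the Pell equation \<open>u\<^sup>2 - 3 m v\<^sup>2 = 1\<close> has a solution with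
  \<open>v \<noteq> 0\<close>, which makes \<open>u + v \<surd>(-m) (2 A - 1)\<close> a hyperbolic element commuting with \<open>A\<close>, and some
  power of it lies in \<open>\<Gamma>\<close>. So the quotient is a line modulo an infinite cyclic group of
  translations.\<close>

subsection \<open>The Pell equation\<close>

text \<open>By Dirichlet, infinitely many reduced fractions h/k lie within 1/k^2 of sqrt D, and
  their norms h^2 - D k^2 are bounded. Two of them therefore share a norm n and agree modulo n;
  their quotient is then integral and has norm 1.\<close>

lemma Pell_solution:
  fixes D :: nat
  assumes nsq: "\<And>k :: nat. k ^ 2 \<noteq> D"
  obtains u v :: int where "u ^ 2 - int D * v ^ 2 = 1" "v \<noteq> 0"
proof -
  let ?S = "approx_set (sqrt D)"
  define N where "N = (\<lambda>(h :: int, k :: int). h ^ 2 - int D * k ^ 2)"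
  have irr: "sqrt D \<notin> \<rat>"
  proof
    assume "sqrt D \<in> \<rat>"
    moreover have "algebraic_int (sqrt D)"
      by (intro algebraic_int_sqrt algebraic_int_of_nat)
    ultimately obtain k where k: "sqrt D = of_int k"
      by (meson Ints_cases rational_algebraic_int_is_int)
    then have "real D = of_int (k ^ 2)"
      by (metis of_int_power of_nat_0_le_iff real_sqrt_pow2)
    then have "int D = k ^ 2"
      by (metis of_int_eq_iff of_int_of_nat_eq)
    then have "(nat \<bar>k\<bar>) ^ 2 = D"
      by (metis abs_ge_zero nat_int nat_power_eq power2_abs)
    with nsq show False by blast
  qed
  then have inf: "infinite ?S"
    using rational_iff_finite_approx_set by blast
  define M where "M = \<lceil>2 * sqrt D + 1\<rceil>"
  have "N p \<in> {-M..M}" if pS: "p \<in> ?S" for p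
  proof -
    obtain h k where p: "p = (h, k)" "k > 0" "\<bar>sqrt D - of_int h / of_int k\<bar> < 1/k\<^sup>2"
      using pS by (auto simp: approx_set_def)
    define e where "e = real_of_int h - of_int k * sqrt D"
    have k: "real_of_int k \<ge> 1" using p by simp
    have "\<bar>e\<bar> = real_of_int k * \<bar>sqrt D - of_int h / of_int k\<bar>"
      using k by (simp add: e_def abs_mult[symmetric] field_simps)
    also have "\<dots> < of_int k * (1 / k\<^sup>2)"
      using p k by (intro mult_strict_left_mono) auto
    finally have e: "\<bar>e\<bar> < 1 / k"
      using k by (simp add: power2_eq_square)
    \<comment> \<open>The norm factors as (h - k sqrt D)(h + k sqrt D), and the second factor is
      \<open>e\<close> plus twice k sqrt D. The first is smaller than 1/k, which cancels the growth
      of the second.\<close>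
    have "real_of_int (N p) = e * (2 * (of_int k * sqrt D) + e)"
      by (simp add: N_def p e_def algebra_simps power2_eq_square)
    then have "\<bar>real_of_int (N p)\<bar> = \<bar>e\<bar> * \<bar>2 * (of_int k * sqrt D) + e\<bar>"
      by (simp add: abs_mult)
    also have "\<dots> \<le> (1 / k) * (2 * (of_int k * sqrt D) + 1 / k)"
      using e k by (intro mult_mono) (auto intro!: order_trans[OF abs_triangle_ineq])
    also have "\<dots> = 2 * sqrt D + (1 / k)\<^sup>2"
      using k by (simp add: field_simps power2_eq_square)
    also have "\<dots> \<le> 2 * sqrt D + 1"
      using k by (simp add: power_le_one)
    finally have "\<bar>real_of_int (N p)\<bar> \<le> of_int M"
      unfolding M_def by linarith
    then show ?thesis by auto
  qed
  then have "finite (N ` ?S)"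
    by (meson finite_atLeastAtMost_int finite_subset image_subsetI)
  from pigeonhole_infinite[OF inf this] obtain p0 where
    p0: "p0 \<in> ?S" and inf1: "infinite {p \<in> ?S. N p = N p0}" (is "infinite ?T") by blast
  define n where "n = N p0"
  have n0: "n \<noteq> 0"
  proof
    assume "n = 0"
    obtain h k where p: "p0 = (h, k)" "k > 0" using p0 by (auto simp: approx_set_def)
    then have "real_of_int (h ^ 2) = of_int (int D * k ^ 2)"
      using \<open>n = 0\<close> by (simp add: n_def N_def)
    then have "sqrt D = \<bar>of_int h / of_int k\<bar>"
      using p(2) by (intro real_sqrt_unique) (simp_all add: power_divide field_simps)
    then show False using irr by simp
  qed
  define R where "R = (\<lambda>(h :: int, k :: int). (h mod n, k mod n))"
  have "R p \<in> {-\<bar>n\<bar>..\<bar>n\<bar>} \<times> {-\<bar>n\<bar>..\<bar>n\<bar>}" for p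
    using n0 abs_mod_less[of n "fst p"] abs_mod_less[of n "snd p"]
    by (auto simp: R_def split_beta)
  then have "finite (R ` ?T)"
    by (intro finite_subset[of "R ` ?T" "{-\<bar>n\<bar>..\<bar>n\<bar>} \<times> {-\<bar>n\<bar>..\<bar>n\<bar>}"]) blast+
  from pigeonhole_infinite[OF inf1 this] obtain p1 where
    p1: "p1 \<in> ?T" and inf2: "infinite {p \<in> ?T. R p = R p1}" (is "infinite ?U") by blast
  have "\<exists>p2 \<in> ?U. p2 \<noteq> p1"
    using inf2 by (metis (no_types, lifting) finite.emptyI finite_insert finite_subset insertCI subsetI)
  then obtain p2 where p2: "p2 \<in> ?U" "p2 \<noteq> p1" by blast
  obtain a b where ab: "p1 = (a, b)" "b > 0" "coprime a b" "a ^ 2 - int D * b ^ 2 = n"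
    using p1 by (auto simp: approx_set_def N_def n_def)
  obtain c d where cd: "p2 = (c, d)" "d > 0" "coprime c d" "c ^ 2 - int D * d ^ 2 = n"
    using p2 by (auto simp: approx_set_def N_def n_def)
  have "n dvd c - a" "n dvd d - b"
    using p2 by (auto simp: R_def ab cd mod_eq_dvd_iff)
  then obtain x y where xy: "c = a + n * x" "d = b + n * y"
    by (metis add.commute diff_eq_eq dvd_def)
  \<comment> \<open>These are the coordinates of (a - b sqrt D)(c + d sqrt D) / n. Substituting c =
    a + n x and d = b + n y turns it into 1 + (a - b sqrt D)(x + y sqrt D), which is visibly
    integral.\<close>
  define u v where "u = 1 + a * x - int D * b * y" and "v = a * y - b * x"
  have u: "n * u = a * c - int D * b * d"
  proof -
    have "n * u = n + n * (a * x - int D * b * y)" by (simp add: u_def algebra_simps)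
    also have "\<dots> = a * c - int D * b * d"
      unfolding xy ab(4)[symmetric] by (simp add: algebra_simps power2_eq_square)
    finally show ?thesis .
  qed
  have v: "n * v = a * d - b * c"
    by (simp add: v_def xy algebra_simps)
  have "n ^ 2 * (u ^ 2 - int D * v ^ 2) = (n * u) ^ 2 - int D * (n * v) ^ 2"
    by (simp add: algebra_simps)
  also have "\<dots> = (a ^ 2 - int D * b ^ 2) * (c ^ 2 - int D * d ^ 2)"
    unfolding u v by (simp add: algebra_simps power2_eq_square)
  also have "\<dots> = n ^ 2"
    using ab cd by (simp add: power2_eq_square)
  finally have "u ^ 2 - int D * v ^ 2 = 1"
    using n0 by simp
  \<comment> \<open>For \<open>v = 0\<close> the fractions a/b and c/d would coincide; both are
    reduced with positive denominator, so \<open>p1\<close> and \<open>p2\<close> would be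
    equal.\<close>
  moreover have "v \<noteq> 0"
  proof
    assume "v = 0"
    then have eq: "a * d = c * b" using v by (simp add: mult.commute)
    have "b dvd d" "d dvd b"
      using ab(3) cd(3) eq by (metis coprime_commute coprime_dvd_mult_right_iff dvd_triv_right,
       metis coprime_commute coprime_dvd_mult_right_iff dvd_triv_right)
    then have "b = d" using ab(2) cd(2) by (simp add: zdvd_antisym_nonneg)
    with eq ab cd p2 show False by simp
  qed
  ultimately show ?thesis using that by blast
qed

subsection \<open>Imaginary quadratic integers\<close>

text \<open>The square of the reduced denominator is coprime to the square of the numerator, so it
  must divide \<open>m\<close>. Used to bound the denominator of the imaginary coordinate of an
  integer of the field.\<close>

lemma squarefree_mult_square_Ints:
  fixes q :: real
  assumes "squarefree m" "q \<in> \<rat>" "real m * q\<^sup>2 \<in> \<int>"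
  shows "q \<in> \<int>"
proof -
  obtain a b where ab: "b > 0" "coprime a b" "q = of_int a / of_int b"
    using assms(2) by (auto elim: Rats_cases')
  obtain k where k: "real m * q\<^sup>2 = of_int k"
    using assms(3) by (auto elim: Ints_cases)
  have "real_of_int (int m * a\<^sup>2) = of_int (k * b\<^sup>2)"
    using k ab by (simp add: power_divide field_simps)
  then have eq: "int m * a\<^sup>2 = k * b\<^sup>2"
    by (simp only: of_int_eq_iff)
  have "coprime (a\<^sup>2) (b\<^sup>2)"
    using ab by simp
  moreover have "b\<^sup>2 dvd int m * a\<^sup>2"
    unfolding eq by simp
  ultimately have "b\<^sup>2 dvd int m"
    by (metis coprime_commute coprime_dvd_mult_left_iff)
  then have "nat b ^ 2 dvd m"
    using ab(1) by (metis int_dvd_int_iff int_nat_eq of_nat_power order_less_imp_le)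
  then have "nat b dvd 1"
    using assms(1) by (auto simp: squarefree_def)
  then have "b = 1"
    using ab(1) by simp
  then show ?thesis
    using ab by simp
qed

section \<open>Integer polynomials and quadratic algebraic integers\<close>

lemma map_poly_of_int_mult:
  "map_poly of_int (p * q) = (map_poly of_int p * map_poly of_int q :: 'a :: comm_ring_1 poly)"
  by (intro poly_eqI) (simp add: coeff_map_poly coeff_mult)

lemma map_poly_of_int_add:
  "map_poly of_int (p + q) = (map_poly of_int p + map_poly of_int q :: 'a :: comm_ring_1 poly)"
  by (intro poly_eqI) (simp add: coeff_map_poly)

lemma map_poly_of_int_smult:
  "map_poly of_int (Polynomial.smult c p) = (Polynomial.smult (of_int c) (map_poly of_int p) :: 'a :: comm_ring_1 poly)"
  by (intro poly_eqI) (simp add: coeff_map_poly)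

text \<open>This is Gauss's lemma at work. A non-real \<open>x\<close> with rational trace and norm
  is a root of a primitive integer quadratic \<open>T\<close> and of no nonzero integer polynomial
  of smaller degree. Hence \<open>T\<close> divides the monic integer polynomial \<open>P\<close>
  over the integers, its leading coefficient is 1 or -1, and the other coefficients are trace and
  norm up to sign.\<close>

lemma algebraic_int_quadratic:
  fixes x :: complex
  assumes "algebraic_int x" "Re x \<in> \<rat>" "(norm x)\<^sup>2 \<in> \<rat>" "Im x \<noteq> 0"
  shows "2 * Re x \<in> \<int>" "(norm x)\<^sup>2 \<in> \<int>"
proof -
  let ?E = "\<lambda>p. poly (map_poly of_int p) x"
  have quad: "?E [:e, d, c:] = of_int c * x\<^sup>2 + of_int d * x + of_int e" for c d e
    by (simp add: map_poly_pCons algebra_simps power2_eq_square)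
  have lin: "p = 0" if "degree p < 2" "?E p = 0" for p
  proof -
    have "p = [:poly.coeff p 0, poly.coeff p 1:]"
      using that(1) by (intro poly_eqI) (auto simp: coeff_pCons coeff_eq_0 split: nat.splits)
    then obtain a b where p: "p = [:a, b:]" by blast
    have "of_int a + x * of_int b = 0"
      using that(2) by (simp add: p map_poly_pCons)
    then have "of_int b * Im x = 0" "of_int a + Re x * of_int b = 0"
      by (auto simp: complex_eq_iff)
    then show ?thesis using assms(4) by (simp add: p)
  qed
  obtain D A B where D: "D \<noteq> 0" "Re x = of_int A / of_int D" "(norm x)\<^sup>2 = of_int B / of_int D"
  proof -
    obtain A1 D1 where 1: "D1 > 0" "Re x = of_int A1 / of_int D1"
      using assms(2) by (auto elim: Rats_cases')
    obtain A2 D2 where 2: "D2 > 0" "(norm x)\<^sup>2 = of_int A2 / of_int D2"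
      using assms(3) by (auto elim: Rats_cases')
    show ?thesis
      using 1 2 by (intro that[of "D1 * D2" "A1 * D2" "A2 * D1"]) auto
  qed
  \<comment> \<open>\<open>D\<close> times the polynomial with roots \<open>x\<close> and its
    conjugate, where \<open>D\<close> is a common denominator.\<close>
  define T0 where "T0 = [:B, - 2 * A, D:]"
  have T00: "?E T0 = 0"
  proof -
    have "x\<^sup>2 - 2 * Re x * x + (norm x)\<^sup>2 = 0"
      by (simp add: complex_eq_iff power2_eq_square cmod_def algebra_simps)
    then have "of_int D * (x\<^sup>2 - 2 * Re x * x + (norm x)\<^sup>2) = 0"
      by simp
    then show ?thesis
      using D(1) by (simp add: T0_def quad D algebra_simps)
  qed
  define T where "T = primitive_part T0"
  have T0: "T0 \<noteq> 0" using D by (simp add: T0_def)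
  have "?E T0 = of_int (content T0) * ?E T"
    by (metis T_def content_times_primitive_part map_poly_of_int_smult poly_smult)
  then have ET: "?E T = 0" using T00 T0 by simp
  have degT: "degree T = 2"
    using D(1) by (simp add: T_def T0_def)
  have Tne: "T \<noteq> 0" and cT: "content T = 1"
    using T0 by (simp_all add: T_def)
  obtain P :: "int poly" where P: "?E P = 0" "lead_coeff P = 1"
    using assms(1) by (auto simp: algebraic_int_altdef_ipoly)
  \<comment> \<open>Pseudo-division stays over the integers at the price of the factor
    \<open>k\<close>. Since \<open>T\<close> is primitive, \<open>k\<close> divides the content of
    \<open>q\<close> and can be cancelled afterwards.\<close>
  obtain k q where kq: "k \<noteq> 0" "Polynomial.smult k P = T * q + pseudo_mod P T"
    using pseudo_mod(1)[OF Tne] by blast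
  have "?E (Polynomial.smult k P) = ?E T * ?E q + ?E (pseudo_mod P T)"
    by (simp add: kq(2) map_poly_of_int_add map_poly_of_int_mult)
  then have "?E (pseudo_mod P T) = 0"
    using P ET by (simp add: map_poly_of_int_smult)
  then have "pseudo_mod P T = 0"
    using pseudo_mod(2)[OF Tne, of P] degT by (auto intro: lin)
  then have kP: "Polynomial.smult k P = T * q" using kq by simp
  then have "content (Polynomial.smult k P) = content q"
    using cT by (simp add: content_mult)
  then have "normalize k * content P = content q"
    by simp
  then have "k dvd content q"
    by (metis dvd_mult2 dvd_refl normalize_dvd_iff)
  then have "[:k:] dvd q"
    by (simp add: const_poly_dvd_iff_dvd_content)
  then obtain q' where "q = Polynomial.smult k q'"
    by (auto elim!: dvdE)
  then have "Polynomial.smult k P = Polynomial.smult k (T * q')"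
    using kP by simp
  then have "P = T * q'" using kq(1) by (simp add: smult_cancel)
  then have "lead_coeff T * lead_coeff q' = 1"
    using P(2) by (simp add: lead_coeff_mult)
  then have c: "lead_coeff T = 1 \<or> lead_coeff T = -1"
    by (metis dvd_triv_left zdvd1_eq abs_eq_iff abs_1)
  define e d c where "e = poly.coeff T 0" and "d = poly.coeff T 1" and "c = poly.coeff T 2"
  have "T = [:e, d, c:]"
    using degT by (intro poly_eqI)
      (auto simp: coeff_pCons coeff_eq_0 e_def d_def c_def numeral_2_eq_2 split: nat.splits)
  then have eq: "of_int c * x\<^sup>2 + of_int d * x + of_int e = 0"
    using ET quad by simp
  have "Im x * (2 * of_int c * Re x + of_int d) = 0"
    using arg_cong[OF eq, of Im] by (simp add: power2_eq_square algebra_simps)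
  then have 1: "of_int d = - 2 * of_int c * Re x"
    using assms(4) by simp
  have "of_int c * ((Re x)\<^sup>2 - (Im x)\<^sup>2) + of_int d * Re x + of_int e = 0"
    using arg_cong[OF eq, of Re] by (simp add: power2_eq_square algebra_simps)
  then have 2: "of_int e = of_int c * (norm x)\<^sup>2"
    unfolding 1 cmod_power2 by (simp add: power2_eq_square algebra_simps)
  have c1: "c = 1 \<or> c = -1"
    using c by (simp add: degT c_def)
  have "2 * Re x = of_int (- c * d)" "(norm x)\<^sup>2 = of_int (c * e)"
    using c1 1 2 by auto
  then show "2 * Re x \<in> \<int>" "(norm x)\<^sup>2 \<in> \<int>"
    by (metis Ints_of_int)+
qed

lemma csqrt_minus_of_nat: "csqrt (- of_nat m) = \<i> * sqrt m"
  by (simp add: csqrt_of_real_nonpos[of "- real m", simplified])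

text \<open>Here \<open>a\<close> is the trace of \<open>x\<close> and a quarter of the sum is its
  norm. This single description covers every residue of \<open>m\<close> modulo 4 without a case
  distinction.\<close>

lemma ring_of_integers_iff:
  assumes m: "m > 0" "squarefree m"
  shows "x \<in> ring_of_integers m \<longleftrightarrow>
    (\<exists>a b :: int. 4 dvd a\<^sup>2 + int m * b\<^sup>2 \<and> x = Complex (a / 2) (b / 2 * sqrt m))"
proof
  assume "x \<in> ring_of_integers m"
  then obtain p q where pq: "p \<in> \<rat>" "q \<in> \<rat>" and x: "x = p + q * csqrt (- of_nat m)"
    and alg: "algebraic_int x"
    by (auto simp: ring_of_integers_def imag_quadratic_field_def)
  have real: "\<exists>a \<in> \<rat>. r = complex_of_real a" if r: "r \<in> \<rat>" for r
  proof -
    obtain i j :: int where "r = of_int i / of_int j"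
      using r by (auto elim: Rats_cases')
    then have "r = complex_of_real (of_int i / of_int j)" by simp
    then show ?thesis by (intro bexI[of _ "of_int i / of_int j"]) auto
  qed
  obtain a where a: "a \<in> \<rat>" "p = of_real a" using real[OF pq(1)] ..
  obtain b where b: "b \<in> \<rat>" "q = of_real b" using real[OF pq(2)] ..
  note ab = a(1) b(1) a(2) b(2)
  have xab: "x = Complex a (b * sqrt m)"
    by (simp add: x ab csqrt_minus_of_nat complex_eq_iff)
  have norm: "(norm x)\<^sup>2 = a\<^sup>2 + real m * b\<^sup>2"
    by (simp add: xab cmod_power2 power_mult_distrib)
  have ints: "2 * Re x \<in> \<int>" "(norm x)\<^sup>2 \<in> \<int>"
  proof -
    have "2 * Re x \<in> \<int> \<and> (norm x)\<^sup>2 \<in> \<int>"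
    \<comment> \<open>A real \<open>x\<close> is rational and needs the separate fact that rational
      algebraic integers are integers: the quadratic argument applies only off the real
      line.\<close>
    proof (cases "Im x = 0")
      case True
      then have "x = of_real a" by (simp add: xab complex_eq_iff)
      then have "a \<in> \<int>"
        using alg ab(1) rational_algebraic_int_is_int by (metis algebraic_int_of_real_iff)
      moreover have "b = 0" using True m by (simp add: xab)
      ultimately show ?thesis unfolding norm by (simp add: xab)
    next
      case False
      then show ?thesis
        using ab(1,2) alg
        by (intro conjI algebraic_int_quadratic) (simp_all only: norm, simp_all add: xab)
    qed
    then show "2 * Re x \<in> \<int>" "(norm x)\<^sup>2 \<in> \<int>" by auto
  qed
  then obtain i N where iN: "2 * a = of_int i" "a\<^sup>2 + real m * b\<^sup>2 = of_int N"
    unfolding norm by (auto simp: xab elim!: Ints_cases)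
  have eq: "real m * (2 * b)\<^sup>2 = of_int (4 * N - i\<^sup>2)"
    by (simp add: iN(1)[symmetric] iN(2)[symmetric] power2_eq_square algebra_simps)
  moreover have "2 * b \<in> \<rat>"
    using ab(2) by simp
  ultimately have "2 * b \<in> \<int>"
    using m(2) by (metis Ints_of_int squarefree_mult_square_Ints)
  then obtain j where j: "2 * b = of_int j" by (auto elim: Ints_cases)
  have "real_of_int (int m * j\<^sup>2) = of_int (4 * N - i\<^sup>2)"
    using eq by (simp add: j)
  then have "i\<^sup>2 + int m * j\<^sup>2 = 4 * N"
    unfolding of_int_eq_iff by simp
  then have "4 dvd i\<^sup>2 + int m * j\<^sup>2"
    by simp
  moreover have "x = Complex (i / 2) (j / 2 * sqrt m)"
    by (simp add: xab iN(1)[symmetric] j[symmetric])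
  ultimately show "\<exists>a b :: int. 4 dvd a\<^sup>2 + int m * b\<^sup>2 \<and> x = Complex (a / 2) (b / 2 * sqrt m)"
    by blast
next
  assume "\<exists>a b :: int. 4 dvd a\<^sup>2 + int m * b\<^sup>2 \<and> x = Complex (a / 2) (b / 2 * sqrt m)"
  then obtain a b N :: int where ab: "a\<^sup>2 + int m * b\<^sup>2 = 4 * N"
    and x: "x = Complex (a / 2) (b / 2 * sqrt m)" by (auto elim: dvdE)
  have N: "real_of_int N = ((of_int a)\<^sup>2 + real m * (of_int b)\<^sup>2) / 4"
    using arg_cong[OF ab, of real_of_int] by simp
  have "x \<in> imag_quadratic_field m"
  proof -
    have "x = of_int a / 2 + of_int b / 2 * csqrt (- of_nat m)"
      by (simp add: x csqrt_minus_of_nat complex_eq_iff)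
    moreover have "(of_int a / 2 :: complex) \<in> \<rat>" "(of_int b / 2 :: complex) \<in> \<rat>"
      by simp_all
    ultimately show ?thesis
      unfolding imag_quadratic_field_def by blast
  qed
  moreover have "algebraic_int x"
  proof
    show "lead_coeff [:of_int N, - of_int a, 1 :: complex:] = 1" by simp
    show "\<forall>i. poly.coeff [:of_int N, - of_int a, 1 :: complex:] i \<in> \<int>"
      by (auto simp: coeff_pCons split: nat.splits)
    show "poly [:of_int N, - of_int a, 1 :: complex:] x = 0"
      by (simp add: complex_eq_iff x N power2_eq_square) (simp add: algebra_simps)
  qed
  ultimately show "x \<in> ring_of_integers m"
    by (simp add: ring_of_integers_def)
qed

text \<open>If \<open>a\<close> is even, an odd \<open>b\<close> would force 4 to divide the
  squarefree \<open>m\<close>; if \<open>a\<close> is odd, so is the other summand. The parities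
  settle the divisions by 2 when sums and products are formed.\<close>

lemma ring_of_integers_parity:
  fixes a b :: int
  assumes m: "squarefree m" and "4 dvd a\<^sup>2 + int m * b\<^sup>2"
  shows "even a \<and> even b \<or> odd m \<and> odd a \<and> odd b"
proof (cases "even a")
  case True
  then have "4 dvd a\<^sup>2"
    by (auto elim!: evenE simp: power_mult_distrib)
  then have *: "4 dvd int m * b\<^sup>2"
    using assms(2) by (metis dvd_add_right_iff)
  have "even b"
  proof (rule ccontr)
    assume "odd b"
    then have "coprime (2 ^ 2) (b\<^sup>2)"
      unfolding coprime_power_left_iff coprime_power_right_iff by simp
    then have "4 dvd int m"
      using * by (simp add: coprime_dvd_mult_left_iff)
    then have "2\<^sup>2 dvd m"
      by (simp add: int_dvd_int_iff[symmetric])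
    then show False
      using m squarefreeD[of m 2] by simp
  qed
  with True show ?thesis by blast
next
  case False
  have "even (a\<^sup>2 + int m * b\<^sup>2)"
    using assms(2) by (rule dvd_trans[rotated]) simp
  with False show ?thesis by auto
qed

section \<open>Ring operations and discreteness of the ring of integers\<close>

lemma ring_of_integers_uminus:
  assumes m: "m > 0" "squarefree m" and x: "x \<in> ring_of_integers m"
  shows "- x \<in> ring_of_integers m"
proof -
  obtain a b :: int where "4 dvd a\<^sup>2 + int m * b\<^sup>2" "x = Complex (a / 2) (b / 2 * sqrt m)"
    using x unfolding ring_of_integers_iff[OF m] by blast
  then have "4 dvd (- a)\<^sup>2 + int m * (- b)\<^sup>2 \<and> - x = Complex ((- a) / 2) ((- b) / 2 * sqrt m)"
    by (simp add: complex_eq_iff)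
  then show ?thesis
    unfolding ring_of_integers_iff[OF m] by blast
qed

lemma ring_of_integers_add:
  assumes m: "m > 0" "squarefree m"
    and x: "x \<in> ring_of_integers m" and y: "y \<in> ring_of_integers m"
  shows "x + y \<in> ring_of_integers m"
proof -
  obtain a b :: int where ab: "4 dvd a\<^sup>2 + int m * b\<^sup>2" "x = Complex (a / 2) (b / 2 * sqrt m)"
    using x unfolding ring_of_integers_iff[OF m] by blast
  obtain c d :: int where cd: "4 dvd c\<^sup>2 + int m * d\<^sup>2" "y = Complex (c / 2) (d / 2 * sqrt m)"
    using y unfolding ring_of_integers_iff[OF m] by blast
  \<comment> \<open>Twice this number is the cross term when the norm form is expanded at the
    sum.\<close>
  have "even (a * c + int m * b * d)"
    using ring_of_integers_parity[OF m(2) ab(1)] ring_of_integers_parity[OF m(2) cd(1)] by auto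
  then have "2 * 2 dvd 2 * (a * c + int m * b * d)"
    by (rule mult_dvd_mono[OF dvd_refl])
  then have "4 dvd 2 * (a * c + int m * b * d)"
    by simp
  then have "4 dvd (a\<^sup>2 + int m * b\<^sup>2) + (c\<^sup>2 + int m * d\<^sup>2) + 2 * (a * c + int m * b * d)"
    by (rule dvd_add[OF dvd_add[OF ab(1) cd(1)]])
  also have "\<dots> = (a + c)\<^sup>2 + int m * (b + d)\<^sup>2"
    by (simp add: power2_eq_square algebra_simps)
  finally have "4 dvd (a + c)\<^sup>2 + int m * (b + d)\<^sup>2" .
  moreover have "x + y = Complex ((a + c) / 2) ((b + d) / 2 * sqrt m)"
    unfolding ab(2) cd(2) by (simp add: complex_eq_iff add_divide_distrib distrib_right)
  ultimately show ?thesis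
    unfolding ring_of_integers_iff[OF m] by blast
qed

lemma ring_of_integers_mult:
  assumes m: "m > 0" "squarefree m"
    and x: "x \<in> ring_of_integers m" and y: "y \<in> ring_of_integers m"
  shows "x * y \<in> ring_of_integers m"
proof -
  obtain a b :: int where ab: "4 dvd a\<^sup>2 + int m * b\<^sup>2" "x = Complex (a / 2) (b / 2 * sqrt m)"
    using x unfolding ring_of_integers_iff[OF m] by blast
  obtain c d :: int where cd: "4 dvd c\<^sup>2 + int m * d\<^sup>2" "y = Complex (c / 2) (d / 2 * sqrt m)"
    using y unfolding ring_of_integers_iff[OF m] by blast
  have "even (a * c - int m * b * d)" "even (a * d + b * c)"
    using ring_of_integers_parity[OF m(2) ab(1)] ring_of_integers_parity[OF m(2) cd(1)] by auto
  then obtain e f where e: "a * c - int m * b * d = 2 * e" and f: "a * d + b * c = 2 * f"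
    by (metis evenE)
  obtain i j where ij: "a\<^sup>2 + int m * b\<^sup>2 = 4 * i" "c\<^sup>2 + int m * d\<^sup>2 = 4 * j"
    using ab(1) cd(1) by (metis dvdE)
  \<comment> \<open>Brahmagupta's identity, that is multiplicativity of the norm; \<open>e\<close>
    and \<open>f\<close> are the doubled coordinates of the product.\<close>
  have "4 * (e\<^sup>2 + int m * f\<^sup>2) = (2 * e)\<^sup>2 + int m * (2 * f)\<^sup>2"
    by (simp add: power_mult_distrib)
  also have "\<dots> = (a\<^sup>2 + int m * b\<^sup>2) * (c\<^sup>2 + int m * d\<^sup>2)"
    unfolding e[symmetric] f[symmetric] by (simp add: power2_eq_square algebra_simps)
  finally have "e\<^sup>2 + int m * f\<^sup>2 = 4 * (i * j)"
    by (simp add: ij)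
  then have "4 dvd e\<^sup>2 + int m * f\<^sup>2"
    by simp
  moreover have "x * y = Complex (e / 2) (f / 2 * sqrt m)"
  proof -
    have e': "real_of_int e = (of_int a * of_int c - real m * of_int b * of_int d) / 2"
    using arg_cong[OF e, of real_of_int] by simp
    have f': "real_of_int f = (of_int a * of_int d + of_int b * of_int c) / 2"
    using arg_cong[OF f, of real_of_int] by simp
    have "sqrt m * sqrt m = m" by simp
    then show ?thesis
      unfolding ab(2) cd(2) e' f' by (simp add: complex_eq_iff add_divide_distrib diff_divide_distrib algebra_simps)
  qed
  ultimately show ?thesis
    unfolding ring_of_integers_iff[OF m] by blast
qed

lemma of_int_in_ring_of_integers:
  assumes m: "m > 0" "squarefree m"
  shows "of_int k \<in> ring_of_integers m"
  unfolding ring_of_integers_iff[OF m]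
  by (rule exI[of _ "2 * k"], rule exI[of _ 0]) (simp add: complex_eq_iff power_mult_distrib)

lemma sqrt_in_ring_of_integers:
  assumes m: "m > 0" "squarefree m"
  shows "\<i> * sqrt m \<in> ring_of_integers m"
  unfolding ring_of_integers_iff[OF m]
  by (rule exI[of _ 0], rule exI[of _ 2]) (simp add: complex_eq_iff)

text \<open>Since \<open>sqrt m\<close> is at least 1, a bound on the norm bounds both integer
  coordinates. This is the source of the discreteness of translation lengths.\<close>

lemma finite_ring_of_integers_bounded:
  assumes m: "m > 0" "squarefree m"
  shows "finite {x \<in> ring_of_integers m. norm x \<le> r}"
proof -
  let ?f = "\<lambda>(a :: int, b :: int). Complex (a / 2) (b / 2 * sqrt m)"
  define K where "K = \<lceil>2 * r\<rceil>"
  have "x \<in> ?f ` ({-K..K} \<times> {-K..K})" if x: "x \<in> ring_of_integers m" "norm x \<le> r" for x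
  proof -
    obtain a b :: int where ab: "x = Complex (a / 2) (b / 2 * sqrt m)"
      using x(1) unfolding ring_of_integers_iff[OF m] by blast
    have "\<bar>a / 2\<bar> \<le> r" "\<bar>b / 2 * sqrt m\<bar> \<le> r"
      using abs_Re_le_cmod[of x] abs_Im_le_cmod[of x] x(2) by (auto simp: ab)
    moreover have "\<bar>b / 2\<bar> * 1 \<le> \<bar>b / 2\<bar> * sqrt m"
      using m by (intro mult_left_mono) auto
    ultimately have "\<bar>real_of_int a\<bar> \<le> of_int K" "\<bar>real_of_int b\<bar> \<le> of_int K"
      unfolding K_def by (simp_all add: abs_mult) linarith+
    then show ?thesis
      unfolding ab by (intro image_eqI[of _ _ "(a, b)"]) auto
  qed
  then show ?thesis
    by (intro finite_subset[OF subsetI finite_imageI[of "{-K..K} \<times> {-K..K}" ?f]]) simp_all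
qed

subsection \<open>Matrices of order three and their axes\<close>

lemma matrix_mult_2_nth:
  fixes A B :: "'a :: comm_ring_1^2^2"
  shows "(A ** B) $ i $ j = A $ i $ 1 * B $ 1 $ j + A $ i $ 2 * B $ 2 $ j"
  by (simp add: matrix_matrix_mult_def sum_2)

lemma matrix_2_eq_iff:
  fixes A B :: "'a^2^2"
  shows "A = B \<longleftrightarrow> A $ 1 $ 1 = B $ 1 $ 1 \<and> A $ 1 $ 2 = B $ 1 $ 2 \<and> A $ 2 $ 1 = B $ 2 $ 1 \<and> A $ 2 $ 2 = B $ 2 $ 2"
  by (auto simp: vec_eq_iff forall_2)

lemma mat_2_nth [simp]:
  "mat x $ 1 $ 1 = x" "mat x $ 2 $ 2 = x" "mat x $ 1 $ (2 :: 2) = 0" "mat x $ 2 $ (1 :: 2) = 0"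
  by (simp_all add: mat_def)

text \<open>By Cayley-Hamilton the cube of \<open>A\<close> is (t^2 - 1) A - t, where t is the
  trace. If this is scalar and t^2 differs from 1, then \<open>A\<close> is itself scalar, hence
  plus or minus the identity.\<close>

lemma trace_order_3:
  fixes A :: "complex^2^2"
  assumes det: "det A = 1" and cube: "A ** A ** A = mat 1 \<or> A ** A ** A = - mat 1"
    and ne: "A \<noteq> mat 1" "A \<noteq> - mat 1"
  shows "A $ 1 $ 1 + A $ 2 $ 2 = 1 \<or> A $ 1 $ 1 + A $ 2 $ 2 = - 1"
proof -
  define a b c d where "a = A $ 1 $ 1" and "b = A $ 1 $ 2" and "c = A $ 2 $ 1" and "d = A $ 2 $ 2"
  note defs = a_def[symmetric] b_def[symmetric] c_def[symmetric] d_def[symmetric]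
  define t where "t = a + d"
  have ad: "b * c = a * d - 1"
    using det by (simp add: det_2 defs algebra_simps)
  obtain e :: complex where e: "A ** A ** A = mat e" "e * e = 1"
  proof -
    have "- mat 1 = (mat (- 1) :: complex^2^2)"
      by (simp add: matrix_2_eq_iff)
    then show ?thesis
      using cube that[of 1] that[of "-1"] by auto
  qed
  have "(a * a + b * c) * a + (a * b + b * d) * c = e"
       "(a * a + b * c) * b + (a * b + b * d) * d = 0"
       "(c * a + d * c) * a + (c * b + d * d) * c = 0"
       "(c * a + d * c) * b + (c * b + d * d) * d = e"
    using e(1) by (simp_all add: matrix_2_eq_iff matrix_mult_2_nth defs)
  moreover have "(a * a + b * c) * a + (a * b + b * d) * c = (t * t - 1) * a - t + (b * c - (a * d - 1)) * (2 * a + d)"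
       "(a * a + b * c) * b + (a * b + b * d) * d = (t * t - 1) * b + (b * c - (a * d - 1)) * b"
       "(c * a + d * c) * a + (c * b + d * d) * c = (t * t - 1) * c + (b * c - (a * d - 1)) * c"
       "(c * a + d * c) * b + (c * b + d * d) * d = (t * t - 1) * d - t + (b * c - (a * d - 1)) * (a + 2 * d)"
    unfolding t_def by (simp_all add: algebra_simps)
  ultimately have eqs: "(t * t - 1) * a - t = e" "(t * t - 1) * b = 0" "(t * t - 1) * c = 0"
       "(t * t - 1) * d - t = e"
    using ad by simp_all
  have "t * t = 1"
  proof (rule ccontr)
    assume t: "t * t \<noteq> 1"
    then have bc: "b = 0" "c = 0" using eqs(2,3) by auto
    have "(t * t - 1) * a = (t * t - 1) * d"
      using eqs(1,4) by (simp add: algebra_simps)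
    then have d: "d = a" using t by simp
    then have "a * a = 1" using ad bc by simp
    then have "a = 1 \<or> a = -1" by (simp add: square_eq_1_iff)
    then show False
      using ne bc d by (auto simp: matrix_2_eq_iff defs)
  qed
  then show ?thesis
    by (simp add: square_eq_1_iff t_def defs)
qed

text \<open>Conjugation by \<open>B\<close> preserves the trace but would negate \<open>A\<close>.
  This excludes the minus sign that commuting in \<open>PSL2\<close> leaves open for
  representatives.\<close>

lemma anticommute_trace:
  fixes A B :: "complex^2^2"
  assumes B: "det B = 1" and anti: "B ** A = - (A ** B)"
  shows "A $ 1 $ 1 + A $ 2 $ 2 = 0"
proof -
  define t where "t = A $ 1 $ 1 + A $ 2 $ 2"
  define M where "M = B ** A + A ** B"
  have det: "B $ 1 $ 1 * B $ 2 $ 2 - B $ 1 $ 2 * B $ 2 $ 1 = 1"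
    using B by (simp add: det_2)
  \<comment> \<open>the trace of the adjugate of \<open>B\<close> times \<open>M\<close>\<close>
  have "2 * t * (B $ 1 $ 1 * B $ 2 $ 2 - B $ 1 $ 2 * B $ 2 $ 1) =
      B $ 2 $ 2 * M $ 1 $ 1 - B $ 1 $ 2 * M $ 2 $ 1 - B $ 2 $ 1 * M $ 1 $ 2 + B $ 1 $ 1 * M $ 2 $ 2"
    by (simp add: M_def t_def matrix_mult_2_nth algebra_simps)
  also have "M = 0"
    using anti by (simp add: M_def)
  finally have "2 * t = 0"
    by (simp add: det)
  then have "t = 0" by simp
  then show ?thesis by (simp add: t_def)
qed

section \<open>Continuity of the action and diagonalisation of the rotation\<close>

lemma continuous_on_sl2_act:
  assumes "det A = 1"
  shows "continuous_on hyperbolic_space3 (sl2_act A)"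
proof -
  have ne: "complex_of_real ((norm (A $ 2 $ 1 * fst p + A $ 2 $ 2))\<^sup>2 + (norm (A $ 2 $ 1))\<^sup>2 * (snd p)\<^sup>2) \<noteq> 0"
    if "p \<in> hyperbolic_space3" for p
    using that sl2_act_denominator_pos[OF assms, of "snd p" "fst p"]
    unfolding of_real_eq_0_iff by (auto simp: hyperbolic_space3_def)
  then have ne': "(norm (A $ 2 $ 1 * fst p + A $ 2 $ 2))\<^sup>2 + (norm (A $ 2 $ 1))\<^sup>2 * (snd p)\<^sup>2 \<noteq> 0"
    if "p \<in> hyperbolic_space3" for p
    using that unfolding of_real_eq_0_iff by blast
  show ?thesis
    unfolding sl2_act_def split_beta Let_def
    by (intro continuous_intros ballI ne ne')
qed

lemma sl2_act_diagonal:
  assumes "D $ 1 $ 2 = 0" "D $ 2 $ 1 = 0" "D $ 1 $ 1 * D $ 2 $ 2 = 1"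
  shows "sl2_act D (z, t) = ((D $ 1 $ 1)\<^sup>2 * z, (norm (D $ 1 $ 1))\<^sup>2 * t)"
proof -
  define a d where "a = D $ 1 $ 1" and "d = D $ 2 $ 2"
  have ad: "a * d = 1" and a0: "a \<noteq> 0" and d0: "d \<noteq> 0" using assms(3) by (auto simp: a_def d_def)
  then have d: "d = inverse a" by (simp add: inverse_unique)
  have 1: "a * z * cnj d / of_real ((norm d)\<^sup>2) = a\<^sup>2 * z"
    using d0 a0 unfolding complex_norm_square by (simp add: d power2_eq_square divide_inverse mult_ac)
  have 2: "t / (norm d)\<^sup>2 = (norm a)\<^sup>2 * t"
    using a0 by (simp add: d norm_inverse power_inverse divide_inverse mult_ac)
  show ?thesis
    using 1 2 by (simp add: sl2_act_def assms(1,2) a_def[symmetric] d_def[symmetric])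
qed

text \<open>Determinant and trace 1 make the eigenvalues the two primitive sixth roots of unity. The
  nonzero lower left entry allows an explicit eigenvector matrix.\<close>

locale elliptic_order_3 =
  fixes A :: "complex^2^2"
  assumes det: "det A = 1" and trace: "A $ 1 $ 1 + A $ 2 $ 2 = 1" and off_diag: "A $ 2 $ 1 \<noteq> 0"
begin

definition "\<zeta> = Complex (1 / 2) (sqrt 3 / 2)"

text \<open>The rows of the matrix \<open>Q\<close> below are left eigenvectors of \<open>A\<close>, hence of every \<open>B\<close> that commutes
  with \<open>A\<close>. The eigenvalues of such a \<open>B\<close> are \<open>eigen B\<close> and \<open>eigen' B\<close>; the formulas read them off
  the first column of \<open>B\<close>.\<close>

definition eigen :: "complex^2^2 \<Rightarrow> complex" where
  "eigen B = B $ 1 $ 1 + B $ 2 $ 1 / A $ 2 $ 1 * (\<zeta> - A $ 1 $ 1)"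

definition eigen' :: "complex^2^2 \<Rightarrow> complex" where
  "eigen' B = B $ 1 $ 1 + B $ 2 $ 1 / A $ 2 $ 1 * (1 - \<zeta> - A $ 1 $ 1)"

definition diag :: "complex^2^2 \<Rightarrow> complex^2^2" where
  "diag B = vector [vector [eigen B, 0], vector [0, eigen' B]]"

definition Q :: "complex^2^2" where
  "Q = vector [vector [A $ 2 $ 1, \<zeta> - A $ 1 $ 1],
     vector [- inverse (2 * \<zeta> - 1), (\<zeta> - 1 + A $ 1 $ 1) * inverse (2 * \<zeta> - 1) / A $ 2 $ 1]]"

text \<open>The adjugate of \<open>Q\<close>, which is its inverse because \<open>Q\<close> has
  determinant 1.\<close>

definition P :: "complex^2^2" where
  "P = vector [vector [Q $ 2 $ 2, - Q $ 1 $ 2], vector [- Q $ 2 $ 1, Q $ 1 $ 1]]"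

lemma zeta_sq: "\<zeta> * \<zeta> = \<zeta> - 1"
  by (simp add: \<zeta>_def complex_eq_iff)

lemma zeta_diff: "2 * \<zeta> - 1 = \<i> * sqrt 3" "2 * \<zeta> - 1 \<noteq> 0"
  by (simp_all add: \<zeta>_def complex_eq_iff)

lemma norm_zeta: "norm \<zeta> = 1"
  by (simp add: \<zeta>_def cmod_def power_divide)

text \<open>The factor \<open>inverse (2 * \<zeta> - 1)\<close> in the second row of
  \<open>Q\<close> was chosen for this normalisation, so that \<open>Q\<close> acts on hyperbolic
  space.\<close>

lemma det_Q: "det Q = 1"
proof -
  have "det Q = (\<zeta> - 1 + A $ 1 $ 1) * inverse (2 * \<zeta> - 1) + (\<zeta> - A $ 1 $ 1) * inverse (2 * \<zeta> - 1)"
    using off_diag by (simp add: det_2 Q_def)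
  also have "\<dots> = (2 * \<zeta> - 1) * inverse (2 * \<zeta> - 1)"
    unfolding distrib_right[symmetric] by simp
  finally show ?thesis using zeta_diff(2) by simp
qed

lemma det_P: "det P = 1"
  using det_Q by (simp add: P_def det_2 algebra_simps)

lemma PQ: "P ** Q = mat 1" and QP: "Q ** P = mat 1"
  using det_Q by (simp_all add: P_def det_2 matrix_2_eq_iff matrix_mult_2_nth algebra_simps)

text \<open>As \<open>A\<close> is not scalar, a matrix commuting with it is a polynomial x + y A,
  with y read off the lower left entries. The left eigenvectors of \<open>A\<close> are therefore
  left eigenvectors of \<open>B\<close>.\<close>

lemma Q_commute:
  assumes "B ** A = A ** B"
  shows "Q ** B = diag B ** Q"
proof -
  define a b c d where "a = A $ 1 $ 1" and "b = A $ 1 $ 2" and "c = A $ 2 $ 1" and "d = A $ 2 $ 2"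
  note defs = a_def[symmetric] b_def[symmetric] c_def[symmetric] d_def[symmetric]
  have c0: "c \<noteq> 0" using off_diag by (simp add: c_def)
  have d: "d = 1 - a" using trace by (simp add: defs) (metis add_diff_cancel_left')
  have bc: "b * c = a * (1 - a) - 1"
    using det by (simp add: det_2 defs d algebra_simps)
  define y where "y = B $ 2 $ 1 / c"
  have y: "B $ 2 $ 1 = y * c" using c0 by (simp add: y_def)
  have "B $ 1 $ 1 * a + B $ 1 $ 2 * c = a * B $ 1 $ 1 + b * B $ 2 $ 1"
    "B $ 2 $ 1 * a + B $ 2 $ 2 * c = c * B $ 1 $ 1 + d * B $ 2 $ 1"
    using assms by (simp_all add: matrix_2_eq_iff matrix_mult_2_nth defs)
  then have "B $ 1 $ 2 * c = (y * b) * c" "B $ 2 $ 2 * c = (B $ 1 $ 1 + (1 - 2 * a) * y) * c"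
    by (simp_all add: y d algebra_simps)
  then have B12: "B $ 1 $ 2 = y * b" and B22: "B $ 2 $ 2 = B $ 1 $ 1 + (1 - 2 * a) * y"
    using c0 by simp_all
  have ev: "eigen B = B $ 1 $ 1 + y * (\<zeta> - a)" "eigen' B = B $ 1 $ 1 + y * (1 - \<zeta> - a)"
    by (simp_all add: eigen_def eigen'_def defs y_def)
  \<comment> \<open>Stated for any root of the characteristic polynomial of \<open>A\<close>, so
    that it serves both eigenvalues, \<open>\<zeta>\<close> and \<open>1 - \<zeta>\<close>.\<close>
  have row: "c * B $ 1 $ 2 + (z - a) * B $ 2 $ 2 = (B $ 1 $ 1 + y * (z - a)) * (z - a)"
    if "z * z = z - 1" for z
  proof -
    have "c * B $ 1 $ 2 = y * (b * c)" by (simp add: B12)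
    also have "\<dots> + (z - a) * B $ 2 $ 2 - (B $ 1 $ 1 + y * (z - a)) * (z - a) = y * (z - 1 - z * z)"
      unfolding bc B22 by (simp add: algebra_simps)
    finally show ?thesis by (simp add: that)
  qed
  have z': "(1 - \<zeta>) * (1 - \<zeta>) = (1 - \<zeta>) - 1"
    using zeta_sq by (simp add: algebra_simps)
  define w where "w = inverse (2 * \<zeta> - 1)"
  define k where "k = - w / c"
  have "Q $ 2 $ 1 = - w" "Q $ 2 $ 2 = (\<zeta> - 1 + a) * w / c"
    by (simp_all add: Q_def w_def defs)
  then have Q2: "Q $ 2 $ 1 = k * c" "Q $ 2 $ 2 = k * (1 - \<zeta> - a)"
    using c0 by (simp_all add: k_def field_simps)
  have Q1: "Q $ 1 $ 1 = c" "Q $ 1 $ 2 = \<zeta> - a"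
    by (simp_all add: Q_def defs)
  have "k * c * B $ 1 $ 2 + k * (1 - \<zeta> - a) * B $ 2 $ 2 = k * (c * B $ 1 $ 2 + (1 - \<zeta> - a) * B $ 2 $ 2)"
    by (simp add: algebra_simps)
  also have "\<dots> = (B $ 1 $ 1 + y * (1 - \<zeta> - a)) * (k * (1 - \<zeta> - a))"
    unfolding row[OF z'] by (simp add: algebra_simps)
  finally have r2: "k * c * B $ 1 $ 2 + k * (1 - \<zeta> - a) * B $ 2 $ 2 = (B $ 1 $ 1 + y * (1 - \<zeta> - a)) * (k * (1 - \<zeta> - a))" .
  show ?thesis
    using row[OF zeta_sq] r2
    by (simp add: matrix_2_eq_iff matrix_mult_2_nth diag_def Q1 Q2 ev y algebra_simps)
qed

lemma eigen_mult_eigen':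
  assumes "B ** A = A ** B" "det B = 1"
  shows "eigen B * eigen' B = 1"
proof -
  have "det (Q ** B) = det (diag B ** Q)" using Q_commute[OF assms(1)] by simp
  then show ?thesis
    using assms(2) det_Q by (simp add: det_mul) (simp add: diag_def det_2)
qed

lemma trace_eigen:
  assumes "B ** A = A ** B"
  shows "B $ 1 $ 1 + B $ 2 $ 2 = eigen B + eigen' B"
proof -
  have "B $ 2 $ 1 * A $ 1 $ 1 + B $ 2 $ 2 * A $ 2 $ 1 = A $ 2 $ 1 * B $ 1 $ 1 + A $ 2 $ 2 * B $ 2 $ 1"
    using assms by (simp add: matrix_2_eq_iff matrix_mult_2_nth)
  moreover have "A $ 2 $ 2 = 1 - A $ 1 $ 1"
    using trace by (metis add_diff_cancel_left')
  ultimately show ?thesis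
    using off_diag by (simp add: eigen_def eigen'_def divide_simps) (simp add: algebra_simps)
qed

lemma eigen_mult:
  assumes B: "B ** A = A ** B" and C: "C ** A = A ** C"
  shows "eigen (B ** C) = eigen B * eigen C"
proof -
  \<comment> \<open>The first column of \<open>Q ** X\<close> determines \<open>eigen X\<close> for
    every matrix \<open>X\<close>, so multiplicativity can be read off one entry.\<close>
  have *: "(Q ** X) $ 1 $ 1 = A $ 2 $ 1 * eigen X" for X
    using off_diag by (simp add: matrix_mult_2_nth Q_def eigen_def field_simps)
  have "Q ** (B ** C) = diag B ** (Q ** C)"
    using Q_commute[OF B] by (simp add: matrix_mul_assoc)
  then have "A $ 2 $ 1 * eigen (B ** C) = (diag B ** (Q ** C)) $ 1 $ 1"
    using *[of "B ** C"] by simp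
  also have "\<dots> = eigen B * (A $ 2 $ 1 * eigen C)"
    by (subst matrix_mult_2_nth) (simp add: diag_def *)
  finally show ?thesis using off_diag by simp
qed

text \<open>\<open>Q\<close> moves the axis to the vertical line over 0, where the logarithm of the
  second coordinate is signed hyperbolic arc length.\<close>

definition height :: "complex \<times> real \<Rightarrow> real" where
  "height p = ln (snd (sl2_act Q p))"

definition axis_point :: "real \<Rightarrow> complex \<times> real" where
  "axis_point s = sl2_act P (0, exp s)"

abbreviation "rot_axis \<equiv> {p \<in> hyperbolic_space3. sl2_act A p = p}"

lemma sl2_act_P_Q: "p \<in> hyperbolic_space3 \<Longrightarrow> sl2_act P (sl2_act Q p) = p"
  and sl2_act_Q_P: "p \<in> hyperbolic_space3 \<Longrightarrow> sl2_act Q (sl2_act P p) = p"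
  using sl2_act_mult[OF det_Q det_P] sl2_act_mult[OF det_P det_Q] by (simp_all add: PQ QP sl2_act_one)

lemma sl2_act_Q_commute:
  assumes "B ** A = A ** B" "det B = 1" "p \<in> hyperbolic_space3"
  shows "sl2_act Q (sl2_act B p) =
    ((eigen B)\<^sup>2 * fst (sl2_act Q p), (norm (eigen B))\<^sup>2 * snd (sl2_act Q p))"
proof -
  have ev: "eigen B * eigen' B = 1" using eigen_mult_eigen'[OF assms(1,2)] .
  then have "det (diag B) = 1" by (simp add: diag_def det_2)
  then have "sl2_act Q (sl2_act B p) = sl2_act (diag B) (sl2_act Q p)"
    using assms by (simp add: sl2_act_mult[symmetric] det_Q Q_commute)
  then show ?thesis
    using sl2_act_diagonal[of "diag B" "fst (sl2_act Q p)" "snd (sl2_act Q p)"] ev by (simp add: diag_def)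
qed

text \<open>In the coordinates given by \<open>Q\<close>, the rotation multiplies the complex
  coordinate by \<open>\<zeta>\<close> squared, which is not 1, and keeps the real one.\<close>

lemma axis_iff:
  assumes "p \<in> hyperbolic_space3"
  shows "sl2_act A p = p \<longleftrightarrow> fst (sl2_act Q p) = 0"
proof -
  have ev: "eigen A = \<zeta>" using off_diag by (simp add: eigen_def)
  have "sl2_act A p = p \<longleftrightarrow> sl2_act Q (sl2_act A p) = sl2_act Q p"
    using assms det by (metis sl2_act_P_Q sl2_act_closed)
  also have "\<dots> \<longleftrightarrow> \<zeta>\<^sup>2 * fst (sl2_act Q p) = fst (sl2_act Q p)"
    using sl2_act_Q_commute[OF refl det assms] by (simp add: ev norm_zeta prod_eq_iff)
  also have "\<zeta>\<^sup>2 \<noteq> 1"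
    by (simp add: \<zeta>_def complex_eq_iff power2_eq_square)
  then have "\<zeta>\<^sup>2 * fst (sl2_act Q p) = fst (sl2_act Q p) \<longleftrightarrow> fst (sl2_act Q p) = 0"
    by simp
  finally show ?thesis .
qed

lemma snd_sl2_act_pos: "det B = 1 \<Longrightarrow> p \<in> hyperbolic_space3 \<Longrightarrow> snd (sl2_act B p) > 0"
  using sl2_act_closed[of B p] by (auto simp: hyperbolic_space3_def)

lemma axis_point_height: "p \<in> rot_axis \<Longrightarrow> axis_point (height p) = p"
proof -
  assume p: "p \<in> rot_axis"
  then have "sl2_act Q p = (0, exp (height p))"
    using axis_iff[of p] snd_sl2_act_pos[OF det_Q, of p] by (auto simp: height_def prod_eq_iff)
  then show ?thesis
    using sl2_act_P_Q[of p] p by (simp add: axis_point_def)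
qed

lemma axis_point_in_axis: "axis_point s \<in> rot_axis"
  and height_axis_point: "height (axis_point s) = s"
proof -
  have 0: "(0, exp s) \<in> hyperbolic_space3" by (simp add: hyperbolic_space3_def)
  then have 1: "axis_point s \<in> hyperbolic_space3"
    by (simp add: axis_point_def sl2_act_closed det_P)
  have 2: "sl2_act Q (axis_point s) = (0, exp s)"
    by (simp add: axis_point_def sl2_act_Q_P 0)
  show "axis_point s \<in> rot_axis" using 1 2 axis_iff by simp
  show "height (axis_point s) = s" using 2 by (simp add: height_def)
qed

lemma commute_axis:
  assumes "B ** A = A ** B" "det B = 1" "p \<in> rot_axis"
  shows "sl2_act B p \<in> rot_axis" "height (sl2_act B p) = height p + 2 * ln (norm (eigen B))"
proof -
  have p: "p \<in> hyperbolic_space3" "fst (sl2_act Q p) = 0" using assms(3) axis_iff[of p] by simp_all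
  then show "sl2_act B p \<in> rot_axis"
    using sl2_act_closed[OF assms(2) p(1)] sl2_act_Q_commute[OF assms(1,2) p(1)] axis_iff by simp
  have "eigen B \<noteq> 0" using eigen_mult_eigen'[OF assms(1,2)] by auto
  then show "height (sl2_act B p) = height p + 2 * ln (norm (eigen B))"
    using sl2_act_Q_commute[OF assms(1,2) p(1)] snd_sl2_act_pos[OF det_Q p(1)]
    by (simp add: height_def ln_mult ln_realpow)
qed

lemma continuous_on_height: "continuous_on rot_axis height"
proof -
  have "continuous_on rot_axis (sl2_act Q)"
    using continuous_on_sl2_act[OF det_Q] by (rule continuous_on_subset) auto
  then show ?thesis
    unfolding height_def using snd_sl2_act_pos[OF det_Q]
    by (intro continuous_intros) force+
qed

lemma continuous_on_axis_point: "continuous_on UNIV axis_point"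
  unfolding axis_point_def
  by (rule continuous_on_compose2[OF continuous_on_sl2_act[OF det_P]])
    (auto intro!: continuous_intros simp: hyperbolic_space3_def)

text \<open>\<open>eigen B\<close> is a root of the characteristic polynomial, which the trace
  determines. This passes finiteness from traces to translation lengths.\<close>

lemma finite_eigenvalues:
  assumes "finite T"
  shows "finite {eigen B | B. B ** A = A ** B \<and> det B = 1 \<and> B $ 1 $ 1 + B $ 2 $ 2 \<in> T}"
proof (rule finite_subset)
  let ?R = "\<lambda>t. {x :: complex. poly [:1, - t, 1:] x = 0}"
  show "finite (\<Union>t\<in>T. ?R t)"
    using assms by (intro finite_UN_I poly_roots_finite) auto
  show "{eigen B | B. B ** A = A ** B \<and> det B = 1 \<and> B $ 1 $ 1 + B $ 2 $ 2 \<in> T} \<subseteq> (\<Union>t\<in>T. ?R t)"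
  proof safe
    fix B assume B: "B ** A = A ** B" "det B = 1" "B $ 1 $ 1 + B $ 2 $ 2 \<in> T"
    have "poly [:1, - (B $ 1 $ 1 + B $ 2 $ 2), 1:] (eigen B) = 0"
      using eigen_mult_eigen'[OF B(1,2)] unfolding trace_eigen[OF B(1)] by (simp add: algebra_simps)
    then show "eigen B \<in> (\<Union>t\<in>T. ?R t)" using B(3) by blast
  qed
qed

end

subsection \<open>Quotients of a line by a discrete group of translations\<close>

text \<open>Discreteness provides a least positive element; subtracting a suitable multiple of it
  from any element leaves a remainder that must vanish.\<close>

lemma discrete_additive_subgroup_cyclic:
  fixes S :: "real set"
  assumes add: "\<And>x y. x \<in> S \<Longrightarrow> y \<in> S \<Longrightarrow> x + y \<in> S" and minus: "\<And>x. x \<in> S \<Longrightarrow> - x \<in> S"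
    and disc: "\<And>r. finite {x \<in> S. \<bar>x\<bar> \<le> r}" and nz: "s \<in> S" "s \<noteq> 0"
  obtains l where "l > 0" "S = range (\<lambda>k :: int. of_int k * l)"
proof -
  let ?T = "{x \<in> S. 0 < x \<and> x \<le> \<bar>s\<bar>}"
  have fin: "finite ?T"
    by (rule finite_subset[OF _ disc[of "\<bar>s\<bar>"]]) auto
  have ne: "\<bar>s\<bar> \<in> ?T"
    using nz minus[OF nz(1)] by (auto simp: abs_if)
  define l where "l = Min ?T"
  have "l \<in> ?T"
    unfolding l_def using Min_in[OF fin] ne by blast
  then have l: "l \<in> S" "l > 0" "l \<le> \<bar>s\<bar>" by auto
  have nat: "of_nat n * l \<in> S" for n :: nat
    using add l(1) minus[OF l(1)] add[OF l(1) minus[OF l(1)]] by (induction n) (auto simp: distrib_right)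
  have int: "of_int k * l \<in> S" for k :: int
    using nat minus[OF nat] by (cases k rule: int_cases2) auto
  have "x \<in> range (\<lambda>k :: int. of_int k * l)" if x: "x \<in> S" for x
  proof -
    define y where "y = x + of_int (- \<lfloor>x / l\<rfloor>) * l"
    have y: "y \<in> S" unfolding y_def by (intro add x int)
    have "of_int \<lfloor>x / l\<rfloor> * l \<le> x" "x < (of_int \<lfloor>x / l\<rfloor> + 1) * l"
      using l(2) by (simp_all add: pos_le_divide_eq[symmetric] pos_divide_less_eq[symmetric])
    then have "0 \<le> y" "y < l" by (simp_all add: y_def algebra_simps)
    moreover have "\<not> 0 < y"
    proof
      assume "0 < y"
      then have "y \<in> ?T" using y \<open>y < l\<close> l(3) by simp
      then have "l \<le> y" unfolding l_def using fin by (intro Min_le)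
      with \<open>y < l\<close> show False by simp
    qed
    ultimately have "y = 0" by simp
    then have "x = of_int \<lfloor>x / l\<rfloor> * l" by (simp add: y_def)
    then show ?thesis by (rule range_eqI)
  qed
  with int have "S = range (\<lambda>k :: int. of_int k * l)" by blast
  with l(2) show ?thesis using that by blast
qed

text \<open>Wrapping \<open>h\<close> around the circle with period \<open>l\<close> induces a
  continuous bijection from the quotient. The quotient is compact, being covered by the image of one
  period under the section \<open>g\<close>, and the circle is Hausdorff, so the bijection is a
  homeomorphism.\<close>

lemma quotient_line_by_translations_circle:
  fixes X :: "'a :: topological_space set" and h :: "'a \<Rightarrow> real"
  assumes h: "continuous_on X h" and g: "continuous_on UNIV g" "range g \<subseteq> X"
    and hg: "\<And>s. h (g s) = s"
    and l: "l > 0"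
    and q: "\<And>x y. x \<in> X \<Longrightarrow> y \<in> X \<Longrightarrow> q x = q y \<longleftrightarrow> (\<exists>k :: int. h y = h x + of_int k * l)"
  shows "quotient_topology (top_of_set X) q homeomorphic_space top_of_set (sphere (0 :: complex) 1)"
proof -
  let ?X = "top_of_set X" and ?C = "top_of_set (sphere (0 :: complex) 1)"
  let ?Y = "quotient_topology ?X q"
  define f where "f x = cis (2 * pi * h x / l)" for x
  have f_eq: "f x = f y \<longleftrightarrow> q x = q y" if "x \<in> X" "y \<in> X" for x y
  proof -
    have "f x = f y \<longleftrightarrow> cis (2 * pi * ((h y - h x) / l)) = 1"
      by (auto simp: f_def cis_divide[symmetric] algebra_simps diff_divide_distrib)
    also have "\<dots> \<longleftrightarrow> (\<exists>k :: int. (h y - h x) / l = of_int k)"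
    proof
      assume "cis (2 * pi * ((h y - h x) / l)) = 1"
      then have "cos (2 * pi * ((h y - h x) / l)) = 1"
        by (simp add: complex_eq_iff)
      then obtain k :: int where "2 * pi * ((h y - h x) / l) = of_int k * 2 * pi"
        unfolding cos_one_2pi_int by auto
      then have "2 * pi * ((h y - h x) / l) = 2 * pi * of_int k"
        by (simp only: mult_ac)
      then show "\<exists>k :: int. (h y - h x) / l = of_int k"
        unfolding mult_cancel_left by auto
    next
      assume "\<exists>k :: int. (h y - h x) / l = of_int k"
      then have "(h y - h x) / l \<in> \<int>"
        by auto
      then show "cis (2 * pi * ((h y - h x) / l)) = 1"
        by (rule cis_multiple_2pi)
    qed
    also have "\<dots> \<longleftrightarrow> q x = q y"
      using l that by (simp add: q field_simps)
    finally show ?thesis .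
  qed
  have "continuous_on X f"
    unfolding f_def using l by (intro continuous_intros h) auto
  then have cont: "continuous_map ?X ?C f"
    by (auto simp: f_def)
  obtain F where F: "continuous_map ?Y ?C F" "F ` topspace ?Y = f ` topspace ?X"
    and Fq: "\<And>x. x \<in> topspace ?X \<Longrightarrow> F (q x) = f x"
    by (rule quotient_map_lift_exists[OF quotient_map_quotient_topology cont]) (auto simp: f_eq)
  have gX: "g s \<in> X" for s using g(2) by auto
  have fX: "f ` X = sphere 0 1"
  proof
    show "f ` X \<subseteq> sphere 0 1" by (auto simp: f_def)
    show "sphere 0 1 \<subseteq> f ` X"
    proof
      fix z :: complex assume "z \<in> sphere 0 1"
      then have "z = cis (Arg z)"
        using rcis_cmod_Arg[of z] by (simp add: rcis_def)
      then obtain t where "z = cis t" ..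
      then have "z = f (g (t * l / (2 * pi)))" using l by (simp add: f_def hg)
      then show "z \<in> f ` X" using gX by blast
    qed
  qed
  have "compact_space ?Y"
  proof -
    have "compact (g ` {0..l})"
      using g(1) by (intro compact_continuous_image) (auto intro: continuous_on_subset)
    then have "compactin ?X (g ` {0..l})"
      using gX by (auto simp: compactin_subtopology)
    then have "compactin ?Y (q ` (g ` {0..l}))"
      by (rule image_compactin) (rule quotient_imp_continuous_map[OF quotient_map_quotient_topology])
    also have "q ` (g ` {0..l}) = topspace ?Y"
    proof -
      have "q x \<in> q ` (g ` {0..l})" if x: "x \<in> X" for x
      proof -
        \<comment> \<open>The representative of the class of \<open>x\<close> in the period from 0
          to \<open>l\<close>.\<close>
        define s where "s = h x + of_int (- \<lfloor>h x / l\<rfloor>) * l"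
        have "of_int \<lfloor>h x / l\<rfloor> * l \<le> h x" "h x < (of_int \<lfloor>h x / l\<rfloor> + 1) * l"
          using l by (simp_all add: pos_le_divide_eq[symmetric] pos_divide_less_eq[symmetric])
        then have "s \<in> {0..l}" by (simp add: s_def algebra_simps)
        moreover have "q x = q (g s)"
          unfolding q[OF x gX] hg s_def by blast
        ultimately show ?thesis by blast
      qed
      then show ?thesis using gX by auto
    qed
    finally show ?thesis by (simp add: compact_space_def)
  qed
  moreover have "inj_on F (topspace ?Y)"
    using Fq f_eq by (auto simp: inj_on_def)
  moreover have "F ` topspace ?Y = topspace ?C"
    using F(2) fX by simp
  ultimately have "homeomorphic_map ?Y ?C F"
    using F(1) by (intro continuous_imp_homeomorphic_map) (auto simp: Hausdorff_space_subtopology)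
  then show ?thesis
    by (rule homeomorphic_map_imp_homeomorphic_space)
qed

subsection \<open>The quotient of the axis\<close>

context elliptic_order_3
begin

text \<open>Translation length is a homomorphism from \<B> to the reals. Its image is discrete by
  \<open>disc\<close> and nonzero by \<open>hyp\<close>, hence infinite cyclic, and the orbits on
  the axis are the classes of heights modulo a generator.\<close>

lemma orbit_space_circle:
  fixes \<B> :: "(complex^2^2) set" and K :: "(complex^2^2) set monoid"
  assumes K: "carrier K = (\<lambda>B. {B, - B}) ` \<B>"
    and commute: "\<And>B. B \<in> \<B> \<Longrightarrow> B ** A = A ** B" and det1: "\<And>B. B \<in> \<B> \<Longrightarrow> det B = 1"
    and mult: "\<And>B C. B \<in> \<B> \<Longrightarrow> C \<in> \<B> \<Longrightarrow> B ** C \<in> \<B>"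
    and inv: "\<And>B. B \<in> \<B> \<Longrightarrow> \<exists>C\<in>\<B>. B ** C = mat 1"
    and disc: "\<And>r. finite {t \<in> (\<lambda>B. B $ 1 $ 1 + B $ 2 $ 2) ` \<B>. norm t \<le> r}"
    and hyp: "B0 \<in> \<B>" "norm (eigen B0) \<noteq> 1"
  shows "orbit_space K psl2_act (top_of_set (invariants hyperbolic_space3 psl2_act {A, - A}))
    homeomorphic_space top_of_set (sphere (0 :: complex) 1)"
proof -
  define len where "len B = 2 * ln (norm (eigen B))" for B
  have ev: "eigen B * eigen' B = 1" "eigen B \<noteq> 0" if "B \<in> \<B>" for B
    using eigen_mult_eigen'[OF commute[OF that] det1[OF that]] by auto
  have len_mult: "len (B ** C) = len B + len C" if "B \<in> \<B>" "C \<in> \<B>" for B C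
    using ev(2)[OF that(1)] ev(2)[OF that(2)]
    by (simp add: len_def eigen_mult commute that norm_mult ln_mult)
  have len_1: "len (mat 1) = 0"
    by (simp add: len_def eigen_def)
  have add: "x + y \<in> len ` \<B>" if "x \<in> len ` \<B>" "y \<in> len ` \<B>" for x y
    using that mult by (auto simp: len_mult[symmetric])
  have minus: "- x \<in> len ` \<B>" if x: "x \<in> len ` \<B>" for x
  proof -
    obtain B where B: "B \<in> \<B>" "x = len B" using x by blast
    obtain C where C: "C \<in> \<B>" "B ** C = mat 1" using inv[OF B(1)] by blast
    have "len B + len C = 0"
      using len_mult[OF B(1) C(1)] by (simp add: C(2) len_1)
    then show ?thesis using C(1) B(2) by (intro image_eqI[of _ _ C]) auto
  qed
  have finite_len: "finite {x \<in> len ` \<B>. \<bar>x\<bar> \<le> r}" for r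
  proof -
    \<comment> \<open>The two eigenvalues are mutually inverse, so a length of absolute value at
      most \<open>r\<close> keeps both moduli below \<open>exp r\<close> and the trace below twice
      that.\<close>
    define T where "T = {t \<in> (\<lambda>B. B $ 1 $ 1 + B $ 2 $ 2) ` \<B>. norm t \<le> 2 * exp r}"
    have "x \<in> (\<lambda>z. 2 * ln (norm z)) ` {eigen B | B. B ** A = A ** B \<and> det B = 1 \<and> B $ 1 $ 1 + B $ 2 $ 2 \<in> T}"
      if x: "x \<in> len ` \<B>" "\<bar>x\<bar> \<le> r" for x
    proof -
      obtain B where B: "B \<in> \<B>" "x = len B" using x by blast
      have r: "\<bar>ln (norm (eigen B))\<bar> \<le> r"
        using x(2) by (simp add: B(2) len_def)
      have pos: "norm (eigen B) > 0" using ev(2)[OF B(1)] by simp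
      have e1: "norm (eigen B) \<le> exp r"
        using r pos by (metis abs_le_D1 exp_le_cancel_iff exp_ln)
      have "norm (eigen B) * norm (eigen' B) = 1"
        using ev(1)[OF B(1)] by (metis norm_mult norm_one)
      then have "norm (eigen' B) = exp (- ln (norm (eigen B)))"
        using pos by (simp add: exp_minus field_simps)
      also have "\<dots> \<le> exp r"
        using r by simp
      finally have "norm (B $ 1 $ 1 + B $ 2 $ 2) \<le> 2 * exp r"
        unfolding trace_eigen[OF commute[OF B(1)]]
        using e1 norm_triangle_ineq[of "eigen B" "eigen' B"] by linarith
      then have "B $ 1 $ 1 + B $ 2 $ 2 \<in> T"
        using B(1) by (simp add: T_def)
      then show ?thesis
        using B commute det1 unfolding len_def by blast
    qed
    moreover have "finite ((\<lambda>z. 2 * ln (norm z)) ` {eigen B | B. B ** A = A ** B \<and> det B = 1 \<and> B $ 1 $ 1 + B $ 2 $ 2 \<in> T})"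
      unfolding T_def by (intro finite_imageI finite_eigenvalues disc)
    ultimately show ?thesis
      by (elim finite_subset[rotated]) blast
  qed
  have "len B0 \<noteq> 0"
    using hyp(2) ev(2)[OF hyp(1)] by (simp add: len_def)
  then obtain l where l: "l > 0" "len ` \<B> = range (\<lambda>k :: int. of_int k * l)"
    using discrete_additive_subgroup_cyclic[OF add minus finite_len imageI[OF hyp(1)]] by blast
  have orbit: "orbit K psl2_act x = {y \<in> rot_axis. \<exists>k :: int. height y = height x + of_int k * l}"
    if x: "x \<in> rot_axis" for x
  proof safe
    fix y assume "y \<in> orbit K psl2_act x"
    then obtain B where B: "B \<in> \<B>" "y = sl2_act B x"
      by (auto simp: orbit_def K)
    note ax = commute_axis[OF commute[OF B(1)] det1[OF B(1)] x]
    show "y \<in> hyperbolic_space3" "sl2_act A y = y"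
      using ax(1) by (simp_all add: B(2))
    have "len B \<in> range (\<lambda>k :: int. of_int k * l)"
      using B(1) l(2) by blast
    then show "\<exists>k :: int. height y = height x + of_int k * l"
      using ax(2) by (auto simp: B(2) len_def)
  next
    fix y k assume y: "y \<in> hyperbolic_space3" "sl2_act A y = y" and k: "height y = height x + of_int k * l"
    have "of_int k * l \<in> len ` \<B>"
      unfolding l(2) by blast
    then obtain B where B: "B \<in> \<B>" "of_int k * l = len B" by blast
    note ax = commute_axis[OF commute[OF B(1)] det1[OF B(1)] x]
    have "height (sl2_act B x) = height y"
      using ax(2) by (simp add: k B(2) len_def)
    moreover have "y \<in> rot_axis"
      using y by simp
    ultimately have "sl2_act B x = y"
      using axis_point_height[OF ax(1)] axis_point_height by metis
    then show "y \<in> orbit K psl2_act x"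
      using B(1) by (auto simp: orbit_def K intro!: exI[of _ "{B, - B}"])
  qed
  have "orbit K psl2_act x = orbit K psl2_act y \<longleftrightarrow> (\<exists>k :: int. height y = height x + of_int k * l)"
    if xy: "x \<in> rot_axis" "y \<in> rot_axis" for x y
  proof
    assume eq: "orbit K psl2_act x = orbit K psl2_act y"
    have "y \<in> orbit K psl2_act y"
      unfolding orbit[OF xy(2)] using xy(2) by (auto intro!: exI[of _ 0])
    then show "\<exists>k :: int. height y = height x + of_int k * l"
      unfolding eq[symmetric] orbit[OF xy(1)] by blast
  next
    assume "\<exists>k :: int. height y = height x + of_int k * l"
    then obtain k :: int where k: "height y = height x + of_int k * l" ..
    have "(\<exists>j :: int. height z = height x + of_int j * l) \<longleftrightarrow> (\<exists>j :: int. height z = height y + of_int j * l)" for z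
    proof
      assume "\<exists>j :: int. height z = height x + of_int j * l"
      then obtain j :: int where "height z = height x + of_int j * l" ..
      then have "height z = height y + of_int (j - k) * l" by (simp add: k algebra_simps)
      then show "\<exists>j :: int. height z = height y + of_int j * l" ..
    next
      assume "\<exists>j :: int. height z = height y + of_int j * l"
      then obtain j :: int where "height z = height y + of_int j * l" ..
      then have "height z = height x + of_int (j + k) * l" by (simp add: k algebra_simps)
      then show "\<exists>j :: int. height z = height x + of_int j * l" ..
    qed
    then show "orbit K psl2_act x = orbit K psl2_act y"
      unfolding orbit[OF xy(1)] orbit[OF xy(2)] by simp
  qed
  then have "quotient_topology (top_of_set rot_axis) (orbit K psl2_act)
      homeomorphic_space top_of_set (sphere (0 :: complex) 1)"
    using axis_point_in_axis
    by (intro quotient_line_by_translations_circle[OF continuous_on_height continuous_on_axis_point _ height_axis_point l(1)])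
      blast+
  moreover have "invariants hyperbolic_space3 psl2_act {A, - A} = rot_axis"
    by (simp add: invariants_def)
  ultimately show ?thesis
    by (simp add: orbit_space_def)
qed

end

text \<open>Two powers of \<open>g\<close> lie in the same coset by the pigeonhole principle; the
  difference of their exponents works.\<close>

lemma (in group) pow_in_finite_index_subgroup:
  assumes H: "subgroup H G" and fin: "finite (rcosets H)" and g: "g \<in> carrier G"
  obtains n :: nat where "n > 0" "g [^] n \<in> H"
proof -
  have "range (\<lambda>n :: nat. H #> g [^] n) \<subseteq> rcosets H"
    using g by (auto simp: RCOSETS_def)
  then have "finite (range (\<lambda>n :: nat. H #> g [^] n))"
    using fin by (rule finite_subset)
  then have "\<not> inj (\<lambda>n :: nat. H #> g [^] n)"
    using finite_imageD by blast
  then obtain i j :: nat where ij: "i < j" "H #> g [^] i = H #> g [^] j"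
    unfolding inj_on_def by (metis linorder_neqE_nat)
  have "g [^] j \<in> H #> g [^] i"
    unfolding ij(2) using g H by (intro rcos_self) auto
  then obtain h where h: "h \<in> H" "g [^] j = h \<otimes> g [^] i"
    by (auto simp: r_coset_def)
  have "g [^] (j - i) \<otimes> g [^] i = h \<otimes> g [^] i"
    unfolding h(2)[symmetric] using ij(1) g by (simp add: nat_pow_mult)
  then have "g [^] (j - i) = h"
    using g h(1) subgroup.mem_carrier[OF H] by (subst (asm) right_cancel) auto
  then show ?thesis using that[of "j - i"] ij(1) h(1) by simp
qed

lemma PSL2_mult: "{A, - A} \<otimes>\<^bsub>PSL2 R\<^esub> {B, - B} = {A ** B, - (A ** B)}"
  by (auto simp: PSL2_def FactGroup_def set_mult_def matrix_mult_uminus_2)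

lemma PSL2_one: "\<one>\<^bsub>PSL2 R\<^esub> = {mat 1, - mat 1}"
  by (simp add: PSL2_def FactGroup_def)

subsection \<open>A hyperbolic element commuting with an element of order three\<close>

lemma matrix_mult_commute:
  fixes A B C :: "'a :: semiring_1^'n^'n"
  assumes "B ** A = A ** B" "C ** A = A ** C"
  shows "B ** C ** A = A ** (B ** C)"
proof -
  have "B ** C ** A = B ** A ** C"
    by (simp add: matrix_mul_assoc[symmetric] assms(2))
  then show ?thesis
    by (simp add: assms(1) matrix_mul_assoc)
qed

text \<open>A square equal to 3 m is divisible by 9, so m is 3 times a square, and squarefreeness
  leaves only 3. This makes Pell's equation for 3 m solvable.\<close>

lemma three_mult_not_square:
  assumes "squarefree m" "m \<noteq> 3"
  shows "k ^ 2 \<noteq> 3 * (m :: nat)"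
proof
  assume k: "k ^ 2 = 3 * m"
  then have "3 dvd k"
    using prime_dvd_power[of "3 :: nat" k 2] by simp
  then obtain j where "k = 3 * j" by (elim dvdE)
  with k have m: "m = 3 * j ^ 2" by (simp add: power_mult_distrib)
  then have "j dvd 1"
    using assms(1) squarefreeD[of m j] by simp
  with m assms(2) show False by simp
qed

text \<open>For \<open>m = 3\<close> the ring consists of the Eisenstein integers, which contain a
  sixth root of unity as an additional unit.\<close>

lemma neq_3_if_units_trivial:
  assumes "{u \<in> ring_of_integers m. \<exists>v \<in> ring_of_integers m. u * v = 1} = {1, -1}"
    and m: "m > 0" "squarefree m"
  shows "m \<noteq> 3"
proof
  assume 3: "m = 3"
  let ?z = "Complex (1 / 2) (sqrt 3 / 2)" and ?w = "Complex (1 / 2) (- sqrt 3 / 2)"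
  have "?z \<in> ring_of_integers m"
    unfolding ring_of_integers_iff[OF m] unfolding 3
    by (rule exI[of _ 1], rule exI[of _ 1]) simp
  moreover have "?w \<in> ring_of_integers m"
    unfolding ring_of_integers_iff[OF m] unfolding 3
    by (rule exI[of _ 1], rule exI[of _ "- 1"]) simp
  moreover have "?z * ?w = 1"
    by (simp add: complex_eq_iff)
  ultimately have "?z \<in> {1, -1}"
    using assms(1) by blast
  then show False
    by (simp add: complex_eq_iff)
qed

context elliptic_order_3
begin

text \<open>The eigenvalues of the matrix constructed here are u - v sqrt(3m) and u + v sqrt(3m), so
  Pell's equation says that its determinant is 1, and nonzero \<open>v\<close> keeps the eigenvalues
  off the unit circle.\<close>

lemma hyperbolic_commuting_element:
  assumes R: "\<And>x y. x \<in> R \<Longrightarrow> y \<in> R \<Longrightarrow> x + y \<in> R" "\<And>x y. x \<in> R \<Longrightarrow> y \<in> R \<Longrightarrow> x * y \<in> R"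
      "\<And>k. of_int k \<in> R" "\<i> * sqrt m \<in> R"
    and A: "\<And>i j. A $ i $ j \<in> R"
    and uv: "u ^ 2 - int (3 * m) * v ^ 2 = 1" "v \<noteq> 0" and m: "m > 0"
  obtains B where "\<And>i j. B $ i $ j \<in> R" "det B = 1" "B ** A = A ** B" "norm (eigen B) \<noteq> 1"
proof -
  define w where "w = of_int v * (\<i> * complex_of_real (sqrt m))"
  define a b c d where "a = A $ 1 $ 1" and "b = A $ 1 $ 2" and "c = A $ 2 $ 1" and "d = A $ 2 $ 2"
  note defs = a_def[symmetric] b_def[symmetric] c_def[symmetric] d_def[symmetric]
  \<comment> \<open>\<open>B = u + w (2 A - 1)\<close>, where \<open>(2 A - 1)\<^sup>2 = - 3\<close> by Cayley-Hamilton\<close>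
  define B :: "complex^2^2" where
    "B = vector [vector [of_int u + w * (2 * a + of_int (- 1)), w * (2 * b)],
      vector [w * (2 * c), of_int u + w * (2 * d + of_int (- 1))]]"
  have wR: "w \<in> R" unfolding w_def by (intro R)
  have "2 \<in> R" using R(3)[of 2] by simp
  then have BR: "B $ i $ j \<in> R" for i j
  proof -
    \<comment> \<open>The constant -1 enters \<open>B\<close> as \<open>of_int (- 1)\<close>, so
      that closure under sums and products together with the integers gives membership.\<close>
    have "\<forall>i j. B $ i $ j \<in> R"
      unfolding forall_2 B_def using \<open>2 \<in> R\<close> A wR
      by (simp only: vector_2 a_def b_def c_def d_def R)
    then show ?thesis by blast
  qed
  have d: "d = 1 - a" using trace by (simp add: defs) (metis add_diff_cancel_left')
  have bc: "b * c = a * (1 - a) - 1"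
    using det by (simp add: det_2 defs d algebra_simps)
  have "complex_of_real (sqrt m) * complex_of_real (sqrt m) = of_nat m"
    by (simp add: of_real_mult[symmetric] del: of_real_mult)
  then have ww: "w * w = - (of_int v * of_int v * of_nat m)"
    by (simp add: w_def mult_ac)
  have "det B = of_int u * of_int u + w * w * ((2 * a - 1) * (2 * d - 1) - 4 * (b * c))"
    by (simp add: det_2 B_def d algebra_simps)
  also have "\<dots> = of_int u * of_int u + 3 * (w * w)"
    unfolding bc d by (simp add: algebra_simps)
  also have "\<dots> = of_int (u ^ 2 - int (3 * m) * v ^ 2)"
    unfolding ww by (simp add: power2_eq_square)
  finally have "det B = 1" unfolding uv by simp
  moreover have "B ** A = A ** B"
    by (simp add: matrix_2_eq_iff matrix_mult_2_nth B_def defs d algebra_simps)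
  moreover have "norm (eigen B) \<noteq> 1"
  proof
    define x where "x = of_int v * (sqrt m * sqrt 3)"
    have "eigen B = of_int u + w * (2 * \<zeta> - 1)"
      using off_diag by (simp add: eigen_def B_def defs algebra_simps)
    also have "\<dots> = of_real (of_int u - x)"
      unfolding zeta_diff(1) w_def x_def by (simp add: algebra_simps)
    finally have "norm (eigen B) = \<bar>of_int u - x\<bar>"
      by (simp only: norm_of_real)
    moreover assume "norm (eigen B) = 1"
    ultimately have 1: "of_int u - x = 1 \<or> of_int u - x = - 1"
      by linarith
    have "(sqrt m * sqrt 3) ^ 2 = 3 * m"
      by (simp add: power_mult_distrib)
    then have "(of_int u - x) * (of_int u + x) = of_int (u ^ 2 - int (3 * m) * v ^ 2)"
      by (simp add: x_def power_mult_distrib algebra_simps power2_eq_square)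
    then have "(of_int u - x) * (of_int u + x) = 1" unfolding uv by simp
    with 1 have "x = 0" by auto
    then show False using uv(2) m by (simp add: x_def)
  qed
  ultimately show ?thesis using BR that by blast
qed

end

section \<open>The centralizer of an element of order three in a finite index subgroup\<close>

theorem theorem20:
  fixes m :: nat and \<Gamma> :: "(complex^2^2) set set" and \<gamma> :: "(complex^2^2) set"
  assumes "m > 0" and "squarefree m"
    and "{u \<in> ring_of_integers m. \<exists>v \<in> ring_of_integers m. u * v = 1} = {1, -1}"
    and "subgroup \<Gamma> (bianchi_group m)"
    and "finite (rcosets\<^bsub>bianchi_group m\<^esub> \<Gamma>)"
    and "\<gamma> \<in> \<Gamma>"
    and "group.ord (bianchi_group m) \<gamma> = 3"
  shows "orbit_space
           ((bianchi_group m)\<lparr>carrier := centralizer ((bianchi_group m)\<lparr>carrier := \<Gamma>\<rparr>) \<gamma>\<rparr>)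
           psl2_act
           (top_of_set (invariants hyperbolic_space3 psl2_act \<gamma>))
         homeomorphic_space top_of_set (sphere (0 :: complex) 1)"
proof -
  note m = assms(1,2)
  let ?R = "ring_of_integers m" and ?G = "bianchi_group m"
  have R01: "0 \<in> ?R" "1 \<in> ?R"
    using of_int_in_ring_of_integers[OF m, of 0] of_int_in_ring_of_integers[OF m, of 1] by simp_all
  note R = ring_of_integers_uminus[OF m] ring_of_integers_add[OF m] ring_of_integers_mult[OF m]
  interpret G: group ?G
    unfolding bianchi_group_def by (rule group_PSL2) (fact R01 R)+
  interpret \<Gamma>: subgroup \<Gamma> ?G by fact
  note mult = PSL2_mult[where R = ?R, folded bianchi_group_def]
  note one = PSL2_one[where R = ?R, folded bianchi_group_def]
  have carrier: "carrier ?G = {{B, - B} | B. (\<forall>i j. B $ i $ j \<in> ?R) \<and> det B = 1}"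
    by (simp add: bianchi_group_def carrier_PSL2)
  obtain A1 where A1: "\<gamma> = {A1, - A1}" "\<And>i j. A1 $ i $ j \<in> ?R" "det A1 = 1"
    using \<Gamma>.mem_carrier[OF assms(6)] unfolding carrier by blast
  have "\<gamma> [^]\<^bsub>?G\<^esub> (3 :: nat) = \<one>\<^bsub>?G\<^esub>"
    using G.pow_ord_eq_1[OF \<Gamma>.mem_carrier[OF assms(6)]] assms(7) by simp
  then have "{A1 ** A1 ** A1, - (A1 ** A1 ** A1)} = {mat 1, - mat 1}"
    using \<Gamma>.mem_carrier[OF assms(6)] by (simp add: numeral_3_eq_3 A1(1) mult one)
  then have cube: "A1 ** A1 ** A1 = mat 1 \<or> A1 ** A1 ** A1 = - mat 1"
    by blast
  have "\<gamma> \<noteq> \<one>\<^bsub>?G\<^esub>"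
    using assms(7) by auto
  then have ne: "A1 \<noteq> mat 1" "A1 \<noteq> - mat 1"
    by (auto simp: A1(1) one)
  obtain A where A: "\<gamma> = {A, - A}" "\<And>i j. A $ i $ j \<in> ?R" "det A = 1" "A $ 1 $ 1 + A $ 2 $ 2 = 1"
  proof (cases "A1 $ 1 $ 1 + A1 $ 2 $ 2 = 1")
    case True
    then show ?thesis using that[OF A1] by blast
  next
    case False
    then have "A1 $ 1 $ 1 + A1 $ 2 $ 2 = - 1"
      using trace_order_3[OF A1(3) cube ne] by blast
    then have "- (A1 $ 1 $ 1 + A1 $ 2 $ 2) = 1" by simp
    then show ?thesis
      using A1 R(1) by (intro that[of "- A1"]) (auto simp: det_uminus_2)
  qed
  \<comment> \<open>With a zero here the diagonal entries would be mutually inverse units, hence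
    both 1 or both -1, and the trace could not be 1.\<close>
  have off_diag: "A $ 2 $ 1 \<noteq> 0"
  proof
    assume "A $ 2 $ 1 = 0"
    then have ad: "A $ 1 $ 1 * A $ 2 $ 2 = 1"
      using A(3) by (simp add: det_2)
    then have "A $ 1 $ 1 \<in> {1, -1}"
      using assms(3) A(2) by blast
    then show False
      using ad A(4) by auto
  qed
  interpret elliptic_order_3 A
    using A(3,4) off_diag by unfold_locales
  \<comment> \<open>All matrix representatives, of both signs, of the centralizer of \<gamma> in
    \<Gamma>.\<close>
  define \<B> where "\<B> = {B. B ** A = A ** B \<and> det B = 1 \<and> (\<forall>i j. B $ i $ j \<in> ?R) \<and> {B, - B} \<in> \<Gamma>}"
  let ?K = "?G\<lparr>carrier := centralizer (?G\<lparr>carrier := \<Gamma>\<rparr>) \<gamma>\<rparr>"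
  have K: "carrier ?K = (\<lambda>B. {B, - B}) ` \<B>"
  proof (intro equalityI subsetI)
    fix g assume "g \<in> carrier ?K"
    then have g: "g \<in> \<Gamma>" "g \<otimes>\<^bsub>?G\<^esub> \<gamma> = \<gamma> \<otimes>\<^bsub>?G\<^esub> g"
      by (simp_all add: centralizer_def)
    obtain B where B: "g = {B, - B}" "\<forall>i j. B $ i $ j \<in> ?R" "det B = 1"
      using \<Gamma>.mem_carrier[OF g(1)] unfolding carrier by blast
    have "{B ** A, - (B ** A)} = {A ** B, - (A ** B)}"
      using g(2) by (simp add: A(1) B(1) mult)
    then have "B ** A = A ** B \<or> B ** A = - (A ** B)"
      by blast
    moreover have "B ** A \<noteq> - (A ** B)"
      using anticommute_trace[OF B(3)] A(4) by auto
    ultimately have "B \<in> \<B>"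
      using B g(1) by (simp add: \<B>_def)
    then show "g \<in> (\<lambda>B. {B, - B}) ` \<B>"
      using B(1) by blast
  next
    fix g assume "g \<in> (\<lambda>B. {B, - B}) ` \<B>"
    then show "g \<in> carrier ?K"
      by (auto simp: \<B>_def centralizer_def A(1) mult)
  qed
  have mult_closed: "B ** C \<in> \<B>" if B: "B \<in> \<B>" and C: "C \<in> \<B>" for B C
  proof -
    have "B ** C ** A = A ** (B ** C)"
      using B C by (intro matrix_mult_commute) (simp_all add: \<B>_def)
    moreover have "{B ** C, - (B ** C)} \<in> \<Gamma>"
      using B C \<Gamma>.m_closed by (auto simp: \<B>_def mult[symmetric])
    ultimately show ?thesis
      using B C R(2,3) by (simp add: \<B>_def det_mul matrix_mult_2_nth)
  qed
  have inv: "\<exists>C\<in>\<B>. B ** C = mat 1" if B: "B \<in> \<B>" for B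
  proof -
    have B': "{B, - B} \<in> \<Gamma>" using B by (simp add: \<B>_def)
    then obtain C where C: "inv\<^bsub>?G\<^esub> {B, - B} = {C, - C}" "\<forall>i j. C $ i $ j \<in> ?R" "det C = 1"
      using \<Gamma>.mem_carrier[OF \<Gamma>.m_inv_closed[OF B']] unfolding carrier by blast
    have "{B, - B} \<otimes>\<^bsub>?G\<^esub> {C, - C} = \<one>\<^bsub>?G\<^esub>"
      unfolding C(1)[symmetric] using \<Gamma>.mem_carrier[OF B'] by simp
    then have "B ** C = mat 1 \<or> B ** C = - mat 1"
      unfolding mult one by blast
    \<comment> \<open>The inverse class only determines a matrix up to sign; \<open>D\<close> is the
      representative that inverts \<open>B\<close> exactly.\<close>
    then obtain D where D: "B ** D = mat 1" "{D, - D} = {C, - C}" "\<forall>i j. D $ i $ j \<in> ?R" "det D = 1"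
    proof
      assume "B ** C = mat 1"
      then show ?thesis using that[of C] C by blast
    next
      assume "B ** C = - mat 1"
      then have "B ** (- C) = mat 1" by (simp add: matrix_mult_uminus_2)
      then show ?thesis using that[of "- C"] C R(1) by (auto simp: det_uminus_2)
    qed
    have D': "D ** B = mat 1" using D(1) by (simp add: matrix_left_right_inverse)
    have "D ** A = D ** A ** (B ** D)" by (simp add: D(1))
    also have "\<dots> = D ** (A ** B) ** D" by (simp add: matrix_mul_assoc)
    also have "A ** B = B ** A" using B by (simp add: \<B>_def)
    also have "D ** (B ** A) ** D = (D ** B) ** A ** D" by (simp add: matrix_mul_assoc)
    finally have "D ** A = A ** D" by (simp add: D')
    moreover have "{D, - D} \<in> \<Gamma>"
      unfolding D(2) C(1)[symmetric] using B' by simp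
    ultimately show ?thesis
      using D by (auto simp: \<B>_def)
  qed
  have disc: "finite {t \<in> (\<lambda>B. B $ 1 $ 1 + B $ 2 $ 2) ` \<B>. norm t \<le> r}" for r
    by (rule finite_subset[OF _ finite_ring_of_integers_bounded[OF m, of r]])
      (auto simp: \<B>_def intro!: R(2))
  have "m \<noteq> 3"
    using neq_3_if_units_trivial[OF assms(3) m] .
  then obtain u v :: int where "u ^ 2 - int (3 * m) * v ^ 2 = 1" "v \<noteq> 0"
    using Pell_solution three_mult_not_square[OF m(2)] by metis
  then obtain B0 where B0: "\<And>i j. B0 $ i $ j \<in> ?R" "det B0 = 1" "B0 ** A = A ** B0" "norm (eigen B0) \<noteq> 1"
    using hyperbolic_commuting_element[where R = ?R, OF R(2,3) of_int_in_ring_of_integers[OF m]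
        sqrt_in_ring_of_integers[OF m] A(2) _ _ m(1)] by blast
  have B0G: "{B0, - B0} \<in> carrier ?G"
    unfolding carrier using B0 by blast
  obtain n :: nat where n: "n > 0" "{B0, - B0} [^]\<^bsub>?G\<^esub> n \<in> \<Gamma>"
    using G.pow_in_finite_index_subgroup[OF assms(4,5) B0G] by blast
  \<comment> \<open>A representative is followed through the powers, since \<open>eigen\<close> is
    defined on matrices and not on classes.\<close>
  have "\<exists>C. {B0, - B0} [^]\<^bsub>?G\<^esub> k = {C, - C} \<and> C ** A = A ** C \<and> det C = 1
      \<and> (\<forall>i j. C $ i $ j \<in> ?R) \<and> eigen C = eigen B0 ^ k" for k :: nat
  proof (induction k)
    case 0
    show ?case
      by (rule exI[of _ "mat 1"]) (simp add: one det_I eigen_def forall_2 R01)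
  next
    case (Suc k)
    then obtain C where C: "{B0, - B0} [^]\<^bsub>?G\<^esub> k = {C, - C}" "C ** A = A ** C" "det C = 1"
      "\<forall>i j. C $ i $ j \<in> ?R" "eigen C = eigen B0 ^ k" by blast
    have "C ** B0 ** A = A ** (C ** B0)"
      using C(2) B0(3) by (rule matrix_mult_commute)
    then show ?case
      using C B0 R(2,3)
      by (intro exI[of _ "C ** B0"]) (simp add: mult det_mul eigen_mult matrix_mult_2_nth)
  qed
  then obtain C where C: "{B0, - B0} [^]\<^bsub>?G\<^esub> n = {C, - C}" "C ** A = A ** C" "det C = 1"
      "\<forall>i j. C $ i $ j \<in> ?R" "eigen C = eigen B0 ^ n" by blast
  have CB: "C \<in> \<B>"
    using C n(2) by (simp add: \<B>_def)
  \<comment> \<open>A positive power of a nonnegative real number equals 1 only if the number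
    does.\<close>
  have norm_C: "norm (eigen C) \<noteq> 1"
    using B0(4) n(1) power_eq_imp_eq_base[of "norm (eigen B0)" n 1] by (auto simp: C(5) norm_power)
  have "orbit_space ?K psl2_act (top_of_set (invariants hyperbolic_space3 psl2_act {A, - A}))
      homeomorphic_space top_of_set (sphere (0 :: complex) 1)"
  proof (rule orbit_space_circle[OF K])
    fix B assume "B \<in> \<B>"
    then show "B ** A = A ** B" "det B = 1"
      by (simp_all add: \<B>_def)
  qed (fact mult_closed inv disc CB norm_C)+
  then show ?thesis
    by (simp only: A(1)[symmetric])
qed

end
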